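(* Consider a homogeneous SISO network, that is, a system $x(t+1)=(A+BQC)x(t)+BRu(t)$, $y(t)=SCx(t)$ as described in the context with $m_i=p_i=1$ and $A_i=A_0$, $B_i=B_0$ and $C_i=C_0$ for all $i\in\{1,\dots,N\}$. The topology of this system is identifiable if and only if $G_0(z):=C_0(zI-A_0)^{-1}B_0\neq 0$ (as a rational function) and at least one of the following two conditions holds: (i) $\operatorname{rank}S=N$ and the pair $(Q,R)$ is controllable; (ii) $\operatorname{rank}R=N$ and the pair $(S,Q)$ is observable.
   Context: Network model. Let $N\ge 1$. For $i\in\mathcal V:=\{1,2,\dots,N\}$, let $A_i\in\mathbb R^{n_i\times n_i}$, $B_i\in\mathbb R^{n_i\times m_i}$, $C_i\in\mathbb R^{p_i\times n_i}$ define the discrete-time node system $x_i(t+1)=A_ix_i(t)+B_iv_i(t)$, $w_i(t)=C_ix_i(t)$. The nodes are coupled by $v_i(t)=\sum_{j=1}^N Q_{ij}w_j(t)+R_iu(t)$ with external input $u(t)\in\mathbb R^m$, and the external output is $y(t)=\sum_{i=1}^N S_iw_i(t)\in\mathbb R^p$, where $Q_{ij}\in\mathbb R^{m_i\times p_j}$, $R_i\in\mathbb R^{m_i\times m}$, $S_i\in\mathbb R^{p\times p_i}$. Let $A,B,C$ be the block diagonal matrices with diagonal blocks $A_i$, $B_i$, $C_i$ ($i=1,\dots,N$), respectively; let $Q=(Q_{ij})$ be the block matrix with blocks $Q_{ij}$ (the interconnection matrix), let $R$ be the matrix obtained by stacking $R_1,\dots,R_N$ on top of each other, and $S=\begin{pmatrix}S_1&\cdots&S_N\end{pmatrix}$.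 With $n=\sum_i n_i$ and $x(t)\in\mathbb R^n$ the stacked state, the network is $x(t+1)=(A+BQC)x(t)+BRu(t)$, $y(t)=SCx(t)$, $t=0,1,2,\dots$. The matrices $A,B,C,R,S$ are fixed and known. (When $m_i=p_i=1$ for all $i$, one has $Q\in\mathbb R^{N\times N}$, $R\in\mathbb R^{N\times m}$, $S\in\mathbb R^{p\times N}$.) Identifiability. Let $y_{u,x_0,Q}(\cdot)$ denote the output of the network for input $u(\cdot)$, initial condition $x(0)=x_0$ and interconnection matrix $Q$. Two real interconnection matrices $Q,\bar Q$ (of the same size) are indistinguishable if there exist $x_0,\bar x_0\in\mathbb R^n$ such that $y_{u,x_0,Q}(\cdot)=y_{u,\bar x_0,\bar Q}(\cdot)$ for all input functions $u$; otherwise they are distinguishable. The topology of the network with interconnection matrix $Q$ is identifiable if $Q$ and $\bar Q$ are distinguishable for all real $\bar Q\neq Q$. Controllability and observability. $(Q,R)$ is controllable if $\begin{pmatrix}R&QR&\cdots&Q^{N-1}R\end{pmatrix}$ has rank $N$; $(S,Q)$ is observable if $v\in\mathbb R^N$ and $SQ^kv=0$ for all $k\ge 0$ imply $v=0$. *)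

theory Defs
  imports
    "Jordan_Normal_Form.Gauss_Jordan_Elimination"
    "Jordan_Normal_Form.DL_Rank"
    "HOL-Computational_Algebra.Fraction_Field"
begin

text \<open>
  A network is given by the lists As, Bs, Cs of the matrices of its nodes (whose sizes may differ
  from node to node), the interconnection matrix Q, and the external input and output matrices
  R and S.  Block matrices Q, R, S are plain matrices whose block sizes are determined by
  Bs and Cs.
\<close>

primrec network_state ::
  "real mat list \<Rightarrow> real mat list \<Rightarrow> real mat list \<Rightarrow> real mat \<Rightarrow> real mat
    \<Rightarrow> (nat \<Rightarrow> real vec) \<Rightarrow> real vec \<Rightarrow> nat \<Rightarrow> real vec" where
  "network_state As Bs Cs R Q u x0 0 = x0"
| "network_state As Bs Cs R Q u x0 (Suc t) =
     (diag_block_mat As + diag_block_mat Bs * Q * diag_block_mat Cs)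
         *\<^sub>v network_state As Bs Cs R Q u x0 t
       + (diag_block_mat Bs * R) *\<^sub>v u t"

definition network_output ::
  "real mat list \<Rightarrow> real mat list \<Rightarrow> real mat list \<Rightarrow> real mat \<Rightarrow> real mat \<Rightarrow> real mat
    \<Rightarrow> (nat \<Rightarrow> real vec) \<Rightarrow> real vec \<Rightarrow> nat \<Rightarrow> real vec" where
  "network_output As Bs Cs R S Q u x0 t =
     (S * diag_block_mat Cs) *\<^sub>v network_state As Bs Cs R Q u x0 t"

definition indistinguishable ::
  "real mat list \<Rightarrow> real mat list \<Rightarrow> real mat list \<Rightarrow> real mat \<Rightarrow> real mat
    \<Rightarrow> real mat \<Rightarrow> real mat \<Rightarrow> bool" where
  "indistinguishable As Bs Cs R S Q Q' \<longleftrightarrow>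
     (\<exists>x0 \<in> carrier_vec (dim_row (diag_block_mat As)).
      \<exists>x0' \<in> carrier_vec (dim_row (diag_block_mat As)).
        \<forall>u. (\<forall>t. u t \<in> carrier_vec (dim_col R)) \<longrightarrow>
            network_output As Bs Cs R S Q u x0 = network_output As Bs Cs R S Q' u x0')"

definition topology_identifiable ::
  "real mat list \<Rightarrow> real mat list \<Rightarrow> real mat list \<Rightarrow> real mat \<Rightarrow> real mat \<Rightarrow> real mat \<Rightarrow> bool" where
  "topology_identifiable As Bs Cs R S Q \<longleftrightarrow>
     (\<forall>Q' \<in> carrier_mat (dim_row Q) (dim_col Q).
        Q' \<noteq> Q \<longrightarrow> \<not> indistinguishable As Bs Cs R S Q Q')"

definition mat_rank :: "real mat \<Rightarrow> nat" where
  "mat_rank M = vec_space.rank (dim_row M) M"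

text \<open>The block matrix with the N blocks R, Q R, ..., Q^(N-1) R side by side, where Q is N by N:
  column j lies in block j div m, at position j mod m, where m is the number of columns of R.\<close>

definition controllability_mat :: "real mat \<Rightarrow> real mat \<Rightarrow> real mat" where
  "controllability_mat Q R =
     mat (dim_row Q) (dim_row Q * dim_col R)
       (\<lambda>(i, j). (Q ^\<^sub>m (j div dim_col R) * R) $$ (i, j mod dim_col R))"

definition controllable :: "real mat \<Rightarrow> real mat \<Rightarrow> bool" where
  "controllable Q R \<longleftrightarrow> mat_rank (controllability_mat Q R) = dim_row Q"

definition observable :: "real mat \<Rightarrow> real mat \<Rightarrow> bool" where
  "observable S Q \<longleftrightarrow>
     (\<forall>v \<in> carrier_vec (dim_row Q).
        (\<forall>k. (S * Q ^\<^sub>m k) *\<^sub>v v = 0\<^sub>v (dim_row S)) \<longrightarrow> v = 0\<^sub>v (dim_row Q))"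

text \<open>Real rational functions are the elements of the fraction field of the real polynomials.\<close>

definition ratfun_of_poly :: "real poly \<Rightarrow> real poly fract" where
  "ratfun_of_poly p = Fract p 1"

abbreviation ratfun_mat :: "real mat \<Rightarrow> real poly fract mat" where
  "ratfun_mat M \<equiv> map_mat (\<lambda>c. ratfun_of_poly [:c:]) M"

text \<open>The matrix z I - A is always invertible over the rational functions (its determinant is
  the monic characteristic polynomial of A), so the option returned by the library's
  inversion function is never None for square A.\<close>

definition transfer_mat :: "real mat \<Rightarrow> real mat \<Rightarrow> real mat \<Rightarrow> real poly fract mat" where
  "transfer_mat A B C =
     ratfun_mat C
       * the (mat_inverse (ratfun_of_poly [:0, 1:] \<cdot>\<^sub>m 1\<^sub>m (dim_row A) - ratfun_mat A))
       * ratfun_mat B"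

end

theory Submission
  imports Defs "Jordan_Normal_Form.Char_Poly"
begin

text \<open>
  Two interconnections are indistinguishable if and only if they give the same Markov parameters
  \<open>S C (A + B Q C)\<^sup>k B R\<close>: impulses read these off, and equal Markov parameters make the outputs equal
  for zero initial states (\<open>indistinguishable_iff_markov_parameters\<close>).

  In a homogeneous network of single-input single-output nodes, \<open>C A\<^sup>l B = g\<^sub>l I\<close> with the scalar
  Markov parameters \<open>g\<^sub>l = C\<^sub>0 A\<^sub>0\<^sup>l B\<^sub>0\<close> of a node. Hence the transfer matrix of the network is
  \<open>\<Sum>j. G\<^sub>0\<^bsup>j+1\<^esup> S Q\<^sup>j R\<close>. The rational function \<open>G\<^sub>0\<close> is strictly proper, so unless it is zero its
  powers have different orders at infinity and the products \<open>S Q\<^sup>j R\<close> can be recovered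
  (\<open>network_markov_parameters_eq_iff\<close>). If \<open>G\<^sub>0 = 0\<close>, all interconnections are indistinguishable. Since
  \<open>G\<^sub>0\<close> vanishes exactly if all \<open>g\<^sub>l\<close> do (\<open>transfer_mat_eq_0_iff\<close>), it remains to decide when \<open>Q\<close> is
  determined by the products \<open>S Q\<^sup>j R\<close>.

  If \<open>S\<close> is injective it can be cancelled, and then \<open>Q\<close> is known on the span of the columns of all
  \<open>Q\<^sup>j R\<close>, which is everything for a controllable pair; the second condition is dual. Conversely, if
  \<open>(Q, R)\<close> is not controllable or \<open>(S, Q)\<close> not observable, adding a rank one matrix that lives on the
  uncontrollable or unobservable part leaves all products unchanged. If both pairs are fine but neither
  \<open>S\<close> nor \<open>R\<close> has rank \<open>N\<close>, conjugating \<open>Q\<close> by an invertible matrix \<open>I + v w\<^sup>T\<close> with \<open>S v = 0\<close> and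
  \<open>w\<^sup>T R = 0\<close> gives a different interconnection with the same products
  (\<open>similar_interconnection_same_products\<close>).
\<close>

section \<open>Full rank and controllability as trivial kernels\<close>

lemma pow_mat_Suc_left:
  fixes A :: "'a :: semiring_1 mat"
  assumes A: "A \<in> carrier_mat n n"
  shows "A ^\<^sub>m Suc k = A * A ^\<^sub>m k"
proof (induction k)
  case (Suc k)
  have "A ^\<^sub>m Suc (Suc k) = (A * A ^\<^sub>m k) * A" using Suc by simp
  also have "\<dots> = A * (A ^\<^sub>m k * A)" using A by (intro assoc_mult_mat) auto
  finally show ?case by simp
qed (use A in auto)

lemma eq_vec_if_minus_0:
  fixes u v :: "real vec"
  assumes "u \<in> carrier_vec n" and "v \<in> carrier_vec n" and "u - v = 0\<^sub>v n"
  shows "u = v"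
proof (rule eq_vecI)
  fix i assume "i < dim_vec v"
  then have "(u - v) $ i = u $ i - v $ i" "i < n" using assms(2) by auto
  then show "u $ i = v $ i" using assms(3) by simp
qed (use assms in auto)

text \<open>
  Full column rank forces the columns, which the rank sees only as a set, to be distinct; their
  linear independence is then injectivity of the matrix.
\<close>

lemma mat_rank_eq_dim_col_iff:
  assumes M: "M \<in> carrier_mat p n"
  shows "mat_rank M = n \<longleftrightarrow> (\<forall>v \<in> carrier_vec n. M *\<^sub>v v = 0\<^sub>v p \<longrightarrow> v = 0\<^sub>v n)"
proof -
  interpret vec_space "TYPE(real)" p .
  have rank: "mat_rank M = rank M" using M by (simp add: mat_rank_def)
  show ?thesis
  proof
    assume full: "mat_rank M = n"
    obtain U where U: "maximal U (\<lambda>T. T \<subseteq> set (cols M) \<and> lin_indpt T)"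
      using maximal_exists_superset[of "set (cols M)" "\<lambda>T. T \<subseteq> set (cols M) \<and> lin_indpt T" "{}"]
      by (auto simp: finite_lin_indpt2)
    have "n = card U" using rank_card_indpt[OF M U] full rank by simp
    also have "\<dots> \<le> card (set (cols M))" using U by (intro card_mono) (auto simp: maximal_def)
    finally have "distinct (cols M)"
      using M by (intro card_distinct antisym card_length) simp
    then show "\<forall>v \<in> carrier_vec n. M *\<^sub>v v = 0\<^sub>v p \<longrightarrow> v = 0\<^sub>v n"
      using full_rank_lin_indpt[OF M] lin_depI[OF M] full rank by metis
  next
    assume inj: "\<forall>v \<in> carrier_vec n. M *\<^sub>v v = 0\<^sub>v p \<longrightarrow> v = 0\<^sub>v n"
    have dist: "distinct (cols M)"
    proof (rule ccontr)
      assume "\<not> distinct (cols M)"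
      then obtain i j where ij: "i < n" "j < n" "i \<noteq> j" "col M i = col M j"
        using M by (auto simp: distinct_conv_nth)
      have "M *\<^sub>v (unit_vec n i - unit_vec n j) = 0\<^sub>v p"
        using ij M by (auto simp: mult_minus_distrib_mat_vec[OF M] vec_eq_iff)
      with inj have "unit_vec n i - unit_vec n j = (0\<^sub>v n :: real vec)" by simp
      then have "(unit_vec n i - unit_vec n j :: real vec) $ i = 0" using ij by simp
      with ij show False by simp
    qed
    then show "mat_rank M = n"
      unfolding rank using lin_depE[OF M _ dist] inj lin_indpt_full_rank[OF M dist] by metis
  qed
qed

text \<open>
  If the columns span the whole space, a vector orthogonal to all of them is orthogonal to itself.
\<close>

lemma mat_rank_eq_dim_row_iff:
  assumes M: "M \<in> carrier_mat n m"
  shows "mat_rank M = n \<longleftrightarrow> (\<forall>w \<in> carrier_vec n. M\<^sup>T *\<^sub>v w = 0\<^sub>v m \<longrightarrow> w = 0\<^sub>v n)"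
proof -
  interpret vec_space "TYPE(real)" n .
  have rank: "mat_rank M = rank M" using M by (simp add: mat_rank_def)
  have cols: "set (cols M) \<subseteq> carrier_vec n" using M cols_dim by blast
  have span: "span (set (cols M)) = {y \<in> carrier_vec n. \<exists>x \<in> carrier_vec m. M *\<^sub>v x = y}"
    using col_space_eq[OF M] M by (simp add: col_space_def)
  show ?thesis
  proof
    assume full: "mat_rank M = n"
    obtain U where U: "maximal U (\<lambda>T. T \<subseteq> set (cols M) \<and> lin_indpt T)"
      using maximal_exists_superset[of "set (cols M)" "\<lambda>T. T \<subseteq> set (cols M) \<and> lin_indpt T" "{}"]
      by (auto simp: finite_lin_indpt2)
    then have Uc: "U \<subseteq> set (cols M)" and Ui: "lin_indpt U" by (auto simp: maximal_def)
    have "card U = n" using rank_card_indpt[OF M U] full rank by simp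
    then have "basis U"
      using Uc Ui cols dim_is_n by (intro dim_li_is_basis fin_dim) (auto intro: finite_subset)
    then have "span U = carrier_vec n" by (simp add: basis_def)
    with span_is_monotone[OF Uc] have all: "carrier_vec n \<subseteq> span (set (cols M))" by simp
    show "\<forall>w \<in> carrier_vec n. M\<^sup>T *\<^sub>v w = 0\<^sub>v m \<longrightarrow> w = 0\<^sub>v n"
    proof (intro ballI impI)
      fix w assume w: "w \<in> carrier_vec n" and Mw: "M\<^sup>T *\<^sub>v w = 0\<^sub>v m"
      from all w span obtain x where x: "x \<in> carrier_vec m" "M *\<^sub>v x = w" by auto
      have "w \<bullet> w = (M\<^sup>T *\<^sub>v w) \<bullet> x"
        using transpose_vec_mult_scalar[OF M x(1) w] x(2) by simp
      then have "w \<bullet> w = 0" using x by (simp add: Mw)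
      then show "w = 0\<^sub>v n" using w by (simp add: vec_eq_iff scalar_prod_def sum_nonneg_eq_0_iff)
    qed
  next
    assume inj: "\<forall>w \<in> carrier_vec n. M\<^sup>T *\<^sub>v w = 0\<^sub>v m \<longrightarrow> w = 0\<^sub>v n"
    \<comment> \<open>Over the reals the Gram matrix has the same kernel as the transpose, and its inverse
      provides preimages of all vectors.\<close>
    have MMt: "M * M\<^sup>T \<in> carrier_mat n n" using M by simp
    have det: "det (M * M\<^sup>T) \<noteq> 0"
    proof
      assume "det (M * M\<^sup>T) = 0"
      then obtain w where w: "w \<in> carrier_vec n" "w \<noteq> 0\<^sub>v n" "M * M\<^sup>T *\<^sub>v w = 0\<^sub>v n"
        using det_0_iff_vec_prod_zero_field[OF MMt] by blast
      define z where "z = M\<^sup>T *\<^sub>v w"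
      have z: "z \<in> carrier_vec m" using M w by (simp add: z_def)
      have "z \<bullet> z = w \<bullet> (M *\<^sub>v z)"
        unfolding z_def by (rule transpose_vec_mult_scalar[OF M _ w(1)]) (use M w in simp)
      also have "M *\<^sub>v z = 0\<^sub>v n" using w M by (simp add: z_def flip: assoc_mult_mat_vec)
      finally have "z = 0\<^sub>v m"
        using z w by (simp add: vec_eq_iff scalar_prod_def sum_nonneg_eq_0_iff)
      with inj w show False by (simp add: z_def)
    qed
    have "carrier_vec n \<subseteq> span (set (cols M))"
    proof
      fix y :: "real vec" assume y: "y \<in> carrier_vec n"
      from det_non_zero_imp_unit[OF MMt det, of "()"] obtain X where
        X: "X \<in> carrier_mat n n" "M * M\<^sup>T * X = 1\<^sub>m n"
        by (auto simp: Units_def ring_mat_def)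
      have "M *\<^sub>v (M\<^sup>T *\<^sub>v (X *\<^sub>v y)) = (M * M\<^sup>T * X) *\<^sub>v y"
        using M X(1) y by (simp add: assoc_mult_mat_vec[of _ n m _ n] assoc_mult_mat_vec[of _ n n _ n]
          assoc_mult_mat_vec[of _ m n _ n])
      also have "\<dots> = y" using X y by simp
      finally show "y \<in> span (set (cols M))"
        unfolding span using y M X(1) by (auto intro!: bexI[of _ "M\<^sup>T *\<^sub>v (X *\<^sub>v y)"])
    qed
    then have "span (set (cols M)) = carrier_vec n" using cols span_is_subset2 by auto
    then show "mat_rank M = n" unfolding rank rank_def using dim_is_n by (simp add: module_vec_def)
  qed
qed

lemma controllable_iff:
  assumes Q: "Q \<in> carrier_mat N N" and R: "R \<in> carrier_mat N m"
  shows "controllable Q R \<longleftrightarrow>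
    (\<forall>w \<in> carrier_vec N. (\<forall>j < N. (Q ^\<^sub>m j * R)\<^sup>T *\<^sub>v w = 0\<^sub>v m) \<longrightarrow> w = 0\<^sub>v N)"
proof -
  let ?K = "controllability_mat Q R"
  have K: "?K \<in> carrier_mat N (N * m)" using Q R by (auto simp: controllability_mat_def)
  have "?K\<^sup>T *\<^sub>v w = 0\<^sub>v (N * m) \<longleftrightarrow> (\<forall>j < N. (Q ^\<^sub>m j * R)\<^sup>T *\<^sub>v w = 0\<^sub>v m)"
    if w: "w \<in> carrier_vec N" for w
  proof -
    have entry: "(?K\<^sup>T *\<^sub>v w) $ c = ((Q ^\<^sub>m (c div m) * R)\<^sup>T *\<^sub>v w) $ (c mod m)" if "c < N * m" for c
    proof -
      have "m > 0" using that by (cases m) auto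
      then have "c mod m < m" by simp
      with that Q R w show ?thesis
        by (simp add: controllability_mat_def scalar_prod_def del: index_mult_mat(1))
    qed
    have "?K\<^sup>T *\<^sub>v w = 0\<^sub>v (N * m) \<longleftrightarrow> (\<forall>c < N * m. (?K\<^sup>T *\<^sub>v w) $ c = 0)"
      using K by (auto simp: vec_eq_iff)
    also have "\<dots> \<longleftrightarrow> (\<forall>j < N. \<forall>b < m. ((Q ^\<^sub>m j * R)\<^sup>T *\<^sub>v w) $ b = 0)"
    proof (intro iffI allI impI)
      fix j b assume all: "\<forall>c < N * m. (?K\<^sup>T *\<^sub>v w) $ c = 0" and j: "j < N" and b: "b < m"
      have "j * m + b < (j + 1) * m" using b by simp
      also have "\<dots> \<le> N * m" using j by (intro mult_right_mono) auto
      finally have "j * m + b < N * m" .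
      with all entry[OF this] b show "((Q ^\<^sub>m j * R)\<^sup>T *\<^sub>v w) $ b = 0" by simp
    next
      fix c assume all: "\<forall>j < N. \<forall>b < m. ((Q ^\<^sub>m j * R)\<^sup>T *\<^sub>v w) $ b = 0" and c: "c < N * m"
      then have "m > 0" by (cases m) auto
      then have "c mod m < m" "c div m < N" using c by (auto simp: less_mult_imp_div_less)
      with all entry[OF c] show "(?K\<^sup>T *\<^sub>v w) $ c = 0" by simp
    qed
    also have "\<dots> \<longleftrightarrow> (\<forall>j < N. (Q ^\<^sub>m j * R)\<^sup>T *\<^sub>v w = 0\<^sub>v m)"
      using Q R by (auto simp: vec_eq_iff)
    finally show ?thesis .
  qed
  then show ?thesis
    unfolding controllable_def using Q mat_rank_eq_dim_row_iff[OF K] by simp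
qed

section \<open>Transfer functions and Markov parameters\<close>

lemma (in semiring_hom) mat_hom_smult: "mat\<^sub>h (c \<cdot>\<^sub>m M) = hom c \<cdot>\<^sub>m mat\<^sub>h M"
  by (rule eq_matI) (auto simp: hom_mult)

interpretation ratfun_hom: comm_ring_hom ratfun_of_poly
  by unfold_locales (auto simp: ratfun_of_poly_def One_fract_def Zero_fract_def)

lemma ratfun_of_poly_eq_0_iff: "ratfun_of_poly p = 0 \<longleftrightarrow> p = 0"
  by (simp add: ratfun_of_poly_def Zero_fract_def eq_fract)

interpretation const_hom: comm_ring_hom "\<lambda>c :: real. [:c:]"
  by unfold_locales (auto simp: one_pCons)

text \<open>
  By Cramer's rule this polynomial is the numerator of the rational function
  \<open>C A\<^sup>l (z I - A)\<^bsup>-1\<^esup> B\<close> over the characteristic polynomial of \<open>A\<close>.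
\<close>

definition resolvent_numerator :: "real mat \<Rightarrow> real mat \<Rightarrow> real mat \<Rightarrow> nat \<Rightarrow> real poly" where
  "resolvent_numerator A B C l =
     (map_mat (\<lambda>c. [:c:]) (C * A ^\<^sub>m l) * adj_mat (char_poly_matrix A) * map_mat (\<lambda>c. [:c:]) B) $$ (0, 0)"

text \<open>
  Strict properness of the resolvent: a cofactor is a determinant of size \<open>n - 1\<close> with entries
  of degree at most one.
\<close>

lemma degree_adj_char_poly_matrix:
  assumes A: "A \<in> carrier_mat n n" and ij: "i < n" "j < n"
  shows "degree (adj_mat (char_poly_matrix A) $$ (i, j)) < n"
proof -
  let ?M = "char_poly_matrix A"
  have M: "?M \<in> carrier_mat n n" using A by simp
  have D: "mat_delete ?M j i \<in> carrier_mat (n - 1) (n - 1)"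
    using M by (rule mat_delete_carrier)
  have "degree (?M $$ (a, b)) \<le> 1" if "a < n" "b < n" for a b
    using A that by (auto simp: char_poly_matrix_def degree_add_le)
  then have "degree (det (mat_delete ?M j i)) \<le> 1 * (n - 1)"
    using M by (intro degree_det_le[OF _ D]) (auto simp: mat_delete_def)
  moreover have "adj_mat ?M $$ (i, j) = (if even (j + i) then 1 else -1) * det (mat_delete ?M j i)"
    using M ij by (simp add: adj_mat_def cofactor_def)
  ultimately have "degree (adj_mat ?M $$ (i, j)) \<le> n - 1" by simp
  then show ?thesis using ij by linarith
qed

lemma degree_resolvent_numerator:
  assumes A: "A \<in> carrier_mat n n" and B: "B \<in> carrier_mat n 1" and C: "C \<in> carrier_mat 1 n"
  shows "resolvent_numerator A B C l = 0 \<or> degree (resolvent_numerator A B C l) < n"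
proof (cases "n = 0")
  case True
  with A B C show ?thesis by (simp add: resolvent_numerator_def scalar_prod_def)
next
  case False
  have adj: "adj_mat (char_poly_matrix A) \<in> carrier_mat n n" using A by (intro adj_mat) auto
  have CA: "C * A ^\<^sub>m l \<in> carrier_mat 1 n" using A C by auto
  let ?P = "adj_mat (char_poly_matrix A)"
  have "resolvent_numerator A B C l =
      (\<Sum>j<n. (\<Sum>i<n. [:(C * A ^\<^sub>m l) $$ (0, i):] * ?P $$ (i, j)) * [:B $$ (j, 0):])"
    unfolding resolvent_numerator_def
    using carrier_matD[OF adj] carrier_matD[OF CA] carrier_matD[OF B]
    by (simp add: scalar_prod_def atLeast0LessThan mult.commute del: assoc_mult_mat)
  also have "degree \<dots> \<le> n - 1"
  proof (intro degree_sum_le)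
    fix j assume "j \<in> {..<n}"
    then have "degree (\<Sum>i<n. [:(C * A ^\<^sub>m l) $$ (0, i):] * ?P $$ (i, j)) \<le> n - 1"
      using degree_adj_char_poly_matrix[OF A, of _ j]
      by (intro degree_sum_le) (auto intro!: order_trans[OF degree_smult_le] simp: less_Suc_eq_le[symmetric])
    then show "degree ((\<Sum>i<n. [:(C * A ^\<^sub>m l) $$ (0, i):] * ?P $$ (i, j)) * [:B $$ (j, 0):]) \<le> n - 1"
      by (simp add: order_trans[OF degree_smult_le])
  qed simp
  finally have "degree (resolvent_numerator A B C l) \<le> n - 1" .
  with False show ?thesis by auto
qed

text \<open>
  The identity \<open>z adj(z I - A) = \<chi> I + A adj(z I - A)\<close> between \<open>C A\<^sup>l\<close> and \<open>B\<close>. As the numerators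
  have smaller degree than \<open>\<chi>\<close>, this is a division with remainder that produces the Markov
  parameters \<open>C A\<^sup>l B\<close> as successive quotients.
\<close>

lemma resolvent_numerator_step:
  assumes A: "A \<in> carrier_mat n n" and B: "B \<in> carrier_mat n 1" and C: "C \<in> carrier_mat 1 n"
  shows "[:0, 1:] * resolvent_numerator A B C l =
    smult ((C * A ^\<^sub>m l * B) $$ (0, 0)) (char_poly A) + resolvent_numerator A B C (Suc l)"
proof -
  let ?K = "map_mat (\<lambda>c :: real. [:c:])"
  let ?P = "adj_mat (char_poly_matrix A)"
  define L where "L = ?K (C * A ^\<^sub>m l)"
  have cm: "char_poly_matrix A \<in> carrier_mat n n" using A by simp
  have P: "?P \<in> carrier_mat n n" using adj_mat(1)[OF cm] .
  have L: "L \<in> carrier_mat 1 n" using A C by (auto simp: L_def)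
  have KA: "?K A \<in> carrier_mat n n" and KB: "?K B \<in> carrier_mat n 1" using A B by auto
  have split: "[:0, 1:] \<cdot>\<^sub>m 1\<^sub>m n = char_poly_matrix A + ?K A"
    using A by (intro eq_matI) (auto simp: char_poly_matrix_def)
  have "[:0, 1:] \<cdot>\<^sub>m ?P = ([:0, 1:] \<cdot>\<^sub>m 1\<^sub>m n) * ?P"
    using P by (subst mult_smult_assoc_mat[OF one_carrier_mat P]) simp
  also have "\<dots> = char_poly_matrix A * ?P + ?K A * ?P"
    unfolding split using cm KA P by (rule add_mult_distrib_mat)
  also have "char_poly_matrix A * ?P = char_poly A \<cdot>\<^sub>m 1\<^sub>m n"
    using adj_mat(2)[OF cm] by (simp add: char_poly_def)
  finally have P_eq: "[:0, 1:] \<cdot>\<^sub>m ?P = char_poly A \<cdot>\<^sub>m 1\<^sub>m n + ?K A * ?P" .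
  have LK: "L * ?K A = ?K (C * A ^\<^sub>m Suc l)"
  proof -
    have "L * ?K A = ?K (C * A ^\<^sub>m l * A)" unfolding L_def
      using A C by (intro const_hom.mat_hom_mult[symmetric]) auto
    also have "C * A ^\<^sub>m l * A = C * A ^\<^sub>m Suc l"
      using A C by (simp add: assoc_mult_mat[of _ 1 n _ n _ n])
    finally show ?thesis .
  qed
  have "[:0, 1:] \<cdot>\<^sub>m (L * ?P * ?K B) = L * ([:0, 1:] \<cdot>\<^sub>m ?P) * ?K B"
    unfolding mult_smult_distrib[OF L P] mult_smult_assoc_mat[OF mult_carrier_mat[OF L P] KB] ..
  also have "\<dots> = char_poly A \<cdot>\<^sub>m (L * ?K B) + L * ?K A * ?P * ?K B"
  proof -
    have KP: "?K A * ?P \<in> carrier_mat n n" using KA P by simp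
    have LKP: "L * (?K A * ?P) \<in> carrier_mat 1 n" using L KP by simp
    have cL: "char_poly A \<cdot>\<^sub>m L \<in> carrier_mat 1 n" using L by simp
    have c1: "char_poly A \<cdot>\<^sub>m 1\<^sub>m n \<in> carrier_mat n n" by simp
    have "L * ([:0, 1:] \<cdot>\<^sub>m ?P) = char_poly A \<cdot>\<^sub>m L + L * (?K A * ?P)"
      unfolding P_eq mult_add_distrib_mat[OF L c1 KP] mult_smult_distrib[OF L one_carrier_mat]
      using L by simp
    then have "L * ([:0, 1:] \<cdot>\<^sub>m ?P) * ?K B = char_poly A \<cdot>\<^sub>m (L * ?K B) + L * (?K A * ?P) * ?K B"
      by (simp only: add_mult_distrib_mat[OF cL LKP KB] mult_smult_assoc_mat[OF L KB])
    then show ?thesis by (simp only: assoc_mult_mat[OF L KA P])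
  qed
  also have "L * ?K B = ?K (C * A ^\<^sub>m l * B)" unfolding L_def
    using A B C by (intro const_hom.mat_hom_mult[symmetric]) auto
  finally have eq: "[:0, 1:] \<cdot>\<^sub>m (L * ?P * ?K B) =
    char_poly A \<cdot>\<^sub>m ?K (C * A ^\<^sub>m l * B) + ?K (C * A ^\<^sub>m Suc l) * ?P * ?K B"
    unfolding LK .
  have dims: "dim_row L = 1" "dim_row C = 1" "dim_col B = 1" using L C B by auto
  have "([:0, 1:] \<cdot>\<^sub>m (L * ?P * ?K B)) $$ (0, 0) = [:0, 1:] * (L * ?P * ?K B) $$ (0, 0)"
    by (rule index_smult_mat) (use dims in auto)
  moreover have "(char_poly A \<cdot>\<^sub>m ?K (C * A ^\<^sub>m l * B) + ?K (C * A ^\<^sub>m Suc l) * ?P * ?K B) $$ (0, 0)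
     = char_poly A * [: (C * A ^\<^sub>m l * B) $$ (0, 0) :] + (?K (C * A ^\<^sub>m Suc l) * ?P * ?K B) $$ (0, 0)"
    using dims by (simp del: pow_mat.simps index_mult_mat(1))
  ultimately show ?thesis using eq
    unfolding resolvent_numerator_def L_def[symmetric] by (simp add: mult.commute del: pow_mat.simps)
qed

text \<open>
  If one numerator vanishes, the next one is a constant multiple of \<open>\<chi>\<close> and hence zero by its
  degree, so that the Markov parameter and all later numerators vanish as well.
\<close>

lemma resolvent_numerator_zero_imp:
  assumes A: "A \<in> carrier_mat n n" and B: "B \<in> carrier_mat n 1" and C: "C \<in> carrier_mat 1 n"
    and zero: "resolvent_numerator A B C 0 = 0"
  shows "(C * A ^\<^sub>m l * B) $$ (0, 0) = 0"
proof -
  have chi: "degree (char_poly A) = n" "char_poly A \<noteq> 0"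
    using degree_monic_char_poly[OF A] by auto
  have step: "(C * A ^\<^sub>m l * B) $$ (0, 0) = 0 \<and> resolvent_numerator A B C (Suc l) = 0"
    if "resolvent_numerator A B C l = 0" for l
  proof -
    have eq: "resolvent_numerator A B C (Suc l) = smult (- (C * A ^\<^sub>m l * B) $$ (0, 0)) (char_poly A)"
      using resolvent_numerator_step[OF A B C, of l] that
      by (simp del: pow_mat.simps add: eq_neg_iff_add_eq_0 add.commute)
    have "(C * A ^\<^sub>m l * B) $$ (0, 0) = 0"
      using degree_resolvent_numerator[OF A B C, of "Suc l"] chi unfolding eq
      by (auto simp del: pow_mat.simps simp: degree_smult_eq split: if_splits)
    with eq show ?thesis by simp
  qed
  have "resolvent_numerator A B C l = 0" for l
    by (induction l) (use zero step in blast)+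
  with step show ?thesis by blast
qed

text \<open>
  If the first \<open>n\<close> Markov parameters vanish, the recursion multiplies the numerator by \<open>z\<close> in each
  of \<open>n\<close> steps; a nonzero numerator would reach degree at least \<open>n\<close>.
\<close>

lemma resolvent_numerator_zeroI:
  assumes A: "A \<in> carrier_mat n n" and B: "B \<in> carrier_mat n 1" and C: "C \<in> carrier_mat 1 n"
    and zero: "\<And>l. l < n \<Longrightarrow> (C * A ^\<^sub>m l * B) $$ (0, 0) = 0"
  shows "resolvent_numerator A B C 0 = 0"
proof (rule ccontr)
  let ?c = "resolvent_numerator A B C"
  assume nz: "?c 0 \<noteq> 0"
  have "?c l = monom 1 l * ?c 0" if "l \<le> n" for l
    using that
  proof (induction l)
    case (Suc l)
    then have "?c (Suc l) = [:0, 1:] * ?c l"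
      using resolvent_numerator_step[OF A B C, of l] zero[of l] by simp
    with Suc show ?case by (simp add: monom_Suc)
  qed simp
  from this[of n] have "degree (?c n) = n + degree (?c 0)" "?c n \<noteq> 0"
    using nz by (auto simp: degree_mult_eq degree_monom_eq)
  then show False using degree_resolvent_numerator[OF A B C, of n] by auto
qed

text \<open>
  The consequence of the Cayley--Hamilton theorem that justifies cutting the controllability matrix
  off after \<open>n\<close> blocks.
\<close>

lemma markov_parameters_vanish:
  fixes A B C :: "real mat"
  assumes "A \<in> carrier_mat n n" and "B \<in> carrier_mat n 1" and "C \<in> carrier_mat 1 n"
    and "\<And>l. l < n \<Longrightarrow> (C * A ^\<^sub>m l * B) $$ (0, 0) = 0"
  shows "(C * A ^\<^sub>m l * B) $$ (0, 0) = 0"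
  by (rule resolvent_numerator_zero_imp[OF assms(1-3)], rule resolvent_numerator_zeroI[OF assms(1-3)],
      rule assms(4))

text \<open>
  Over the rational functions the resolvent is the adjugate divided by \<open>\<chi>\<close>, so the transfer
  function vanishes together with the numerator with index zero, and thus with the Markov parameters.
\<close>

lemma transfer_mat_eq_0_iff:
  assumes A: "A \<in> carrier_mat n n" and B: "B \<in> carrier_mat n 1" and C: "C \<in> carrier_mat 1 n"
  shows "transfer_mat A B C = 0\<^sub>m 1 1 \<longleftrightarrow> (\<forall>l. (C * A ^\<^sub>m l * B) $$ (0, 0) = 0)"
proof -
  let ?K = "map_mat (\<lambda>c :: real. [:c:])"
  let ?h = "map_mat ratfun_of_poly"
  let ?M = "char_poly_matrix A"
  let ?P = "adj_mat ?M"
  have cm: "?M \<in> carrier_mat n n" using A by simp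
  have P: "?P \<in> carrier_mat n n" using adj_mat(1)[OF cm] .
  have hM: "?h ?M \<in> carrier_mat n n" and hP: "?h ?P \<in> carrier_mat n n" using cm P by auto
  have chi: "ratfun_of_poly (char_poly A) \<noteq> 0"
    using degree_monic_char_poly[OF A] by (auto simp: ratfun_of_poly_eq_0_iff)
  have zI: "ratfun_of_poly [:0, 1:] \<cdot>\<^sub>m 1\<^sub>m (dim_row A) - ratfun_mat A = ?h ?M"
    using A by (intro eq_matI)
      (auto simp: char_poly_matrix_def ratfun_hom.hom_minus[symmetric] simp flip: ratfun_hom.hom_uminus)
  obtain X where X: "mat_inverse (?h ?M) = Some X"
  proof (cases "mat_inverse (?h ?M)")
    case None
    have "det (?h ?M) \<noteq> 0" using chi by (simp add: char_poly_def)
    then have "?h ?M \<in> Units (ring_mat TYPE(real poly fract) n ())"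
      by (rule det_non_zero_imp_unit[OF hM])
    with mat_inverse(1)[OF hM None, where b = "()"] show ?thesis by blast
  qed
  have inv: "X * ?h ?M = 1\<^sub>m n" and Xc: "X \<in> carrier_mat n n"
    using mat_inverse(2)[OF hM X] by auto
  have "?h ?P = X * ?h ?M * ?h ?P" using inv hP by simp
  also have "\<dots> = X * ?h (?M * ?P)"
    using Xc hM hP cm P by (simp add: ratfun_hom.mat_hom_mult)
  also have "?M * ?P = char_poly A \<cdot>\<^sub>m 1\<^sub>m n" using adj_mat(2)[OF cm] by (simp add: char_poly_def)
  also have "?h \<dots> = ratfun_of_poly (char_poly A) \<cdot>\<^sub>m 1\<^sub>m n"
    by (simp add: ratfun_hom.mat_hom_smult ratfun_hom.mat_hom_one)
  also have "X * \<dots> = ratfun_of_poly (char_poly A) \<cdot>\<^sub>m X"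
    by (simp add: mult_smult_distrib[OF Xc one_carrier_mat] right_mult_one_mat[OF Xc])
  finally have hP_eq: "?h ?P = ratfun_of_poly (char_poly A) \<cdot>\<^sub>m X" .
  have rB: "ratfun_mat B \<in> carrier_mat n 1" and rC: "ratfun_mat C \<in> carrier_mat 1 n" using B C by auto
  have tr: "transfer_mat A B C = ratfun_mat C * X * ratfun_mat B"
    unfolding transfer_mat_def zI X by simp
  have "?h (?K C * ?P * ?K B) = ?h (?K C) * ?h ?P * ?h (?K B)"
    using B C P
    by (simp add: ratfun_hom.mat_hom_mult[of _ 1 n _ 1] ratfun_hom.mat_hom_mult[of _ 1 n _ n]
      del: assoc_mult_mat)
  also have "?h (?K C) = ratfun_mat C" by (intro eq_matI) auto
  also have "?h (?K B) = ratfun_mat B" by (intro eq_matI) auto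
  also have "ratfun_mat C * ?h ?P * ratfun_mat B = ratfun_of_poly (char_poly A) \<cdot>\<^sub>m transfer_mat A B C"
    unfolding hP_eq tr mult_smult_distrib[OF rC Xc] mult_smult_assoc_mat[OF mult_carrier_mat[OF rC Xc] rB] ..
  finally have eq: "?h (?K C * ?P * ?K B) = ratfun_of_poly (char_poly A) \<cdot>\<^sub>m transfer_mat A B C" .
  have trc: "transfer_mat A B C \<in> carrier_mat 1 1" unfolding tr using rB rC Xc by auto
  have num: "resolvent_numerator A B C 0 = (?K C * ?P * ?K B) $$ (0, 0)"
    unfolding resolvent_numerator_def using A C by simp
  have "ratfun_of_poly (resolvent_numerator A B C 0)
      = ratfun_of_poly (char_poly A) * transfer_mat A B C $$ (0, 0)"
    using arg_cong[OF eq, of "\<lambda>M. M $$ (0, 0)"] trc B C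
    unfolding num by (simp del: index_mult_mat(1))
  then have "resolvent_numerator A B C 0 = 0 \<longleftrightarrow> transfer_mat A B C $$ (0, 0) = 0"
    using chi by (metis mult_eq_0_iff ratfun_of_poly_eq_0_iff)
  also have "\<dots> \<longleftrightarrow> transfer_mat A B C = 0\<^sub>m 1 1"
    using trc by (auto intro!: eq_matI)
  finally show ?thesis
    using resolvent_numerator_zero_imp[OF A B C] resolvent_numerator_zeroI[OF A B C] by blast
qed

section \<open>Indistinguishability and Markov parameters\<close>

text \<open>
  The difference between the responses to an impulse and to the zero input no longer depends on the
  initial state, and consists of the columns of the Markov parameters. Conversely, networks with the
  same Markov parameters agree when started at zero.
\<close>

lemma indistinguishable_iff_markov_parameters:
  assumes A: "diag_block_mat As \<in> carrier_mat n n" and B: "diag_block_mat Bs \<in> carrier_mat n q"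
    and C: "diag_block_mat Cs \<in> carrier_mat q' n"
    and Q: "Q \<in> carrier_mat q q'" and Q': "Q' \<in> carrier_mat q q'"
    and R: "R \<in> carrier_mat q m" and S: "S \<in> carrier_mat p q'"
    and M_def: "M = diag_block_mat As + diag_block_mat Bs * Q * diag_block_mat Cs"
    and M'_def: "M' = diag_block_mat As + diag_block_mat Bs * Q' * diag_block_mat Cs"
    and G_def: "G = diag_block_mat Bs * R" and H_def: "H = S * diag_block_mat Cs"
  shows "indistinguishable As Bs Cs R S Q Q' \<longleftrightarrow> (\<forall>k. H * M ^\<^sub>m k * G = H * M' ^\<^sub>m k * G)"
proof
  have M: "M \<in> carrier_mat n n" and M': "M' \<in> carrier_mat n n"
    and G: "G \<in> carrier_mat n m" and H: "H \<in> carrier_mat p n"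
    using A B C Q Q' R S by (auto simp: M_def M'_def G_def H_def)
  note state_Suc = network_state.simps(2)[of As Bs Cs R Q, folded M_def G_def]
    and state_Suc' = network_state.simps(2)[of As Bs Cs R Q', folded M'_def G_def]
  have dims: "dim_row (diag_block_mat As) = n" "dim_col R = m" using A R by auto
  {
    assume markov: "\<forall>k. H * M ^\<^sub>m k * G = H * M' ^\<^sub>m k * G"
    have "network_output As Bs Cs R S Q u (0\<^sub>v n) t = network_output As Bs Cs R S Q' u (0\<^sub>v n) t"
      if u: "\<forall>t. u t \<in> carrier_vec m" for u t
    proof -
      let ?x = "network_state As Bs Cs R Q u (0\<^sub>v n)" and ?x' = "network_state As Bs Cs R Q' u (0\<^sub>v n)"
      have x: "?x t \<in> carrier_vec n" for t
        by (induction t) (use M G u in \<open>auto simp: state_Suc simp del: network_state.simps(2)\<close>)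
      have x': "?x' t \<in> carrier_vec n" for t
        by (induction t) (use M' G u in \<open>auto simp: state_Suc' simp del: network_state.simps(2)\<close>)
      \<comment> \<open>Advancing the state by one step trades it for one more power of the system matrix and
        one Markov parameter, so the induction over time needs all powers \<^term>\<open>k\<close> at once.\<close>
      have push: "(H * Z ^\<^sub>m k) *\<^sub>v (Z *\<^sub>v y + G *\<^sub>v u t) = (H * Z ^\<^sub>m Suc k) *\<^sub>v y + (H * Z ^\<^sub>m k * G) *\<^sub>v u t"
        if Z: "Z \<in> carrier_mat n n" and y: "y \<in> carrier_vec n" for Z y k t
      proof -
        have HZ: "H * Z ^\<^sub>m k \<in> carrier_mat p n" using H Z by simp
        have ut: "u t \<in> carrier_vec m" using u by simp
        have "(H * Z ^\<^sub>m k) *\<^sub>v (Z *\<^sub>v y + G *\<^sub>v u t)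
            = (H * Z ^\<^sub>m k) *\<^sub>v (Z *\<^sub>v y) + (H * Z ^\<^sub>m k) *\<^sub>v (G *\<^sub>v u t)"
          using HZ Z G y ut by (intro mult_add_distrib_mat_vec) auto
        also have "(H * Z ^\<^sub>m k) *\<^sub>v (Z *\<^sub>v y) = (H * Z ^\<^sub>m k * Z) *\<^sub>v y"
          by (rule assoc_mult_mat_vec[OF HZ Z y, symmetric])
        also have "H * Z ^\<^sub>m k * Z = H * Z ^\<^sub>m Suc k"
          using assoc_mult_mat[OF H pow_carrier_mat[OF Z] Z] by simp
        also have "(H * Z ^\<^sub>m k) *\<^sub>v (G *\<^sub>v u t) = (H * Z ^\<^sub>m k * G) *\<^sub>v u t"
          by (rule assoc_mult_mat_vec[OF HZ G ut, symmetric])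
        finally show ?thesis .
      qed
      have "(H * M ^\<^sub>m k) *\<^sub>v ?x t = (H * M' ^\<^sub>m k) *\<^sub>v ?x' t" for k
      proof (induction t arbitrary: k)
        case 0
        have zero: "W *\<^sub>v 0\<^sub>v n = 0\<^sub>v p" if "W \<in> carrier_mat p n" for W :: "real mat"
          using that by (auto simp: vec_eq_iff)
        have "H * Z ^\<^sub>m k \<in> carrier_mat p n" if "Z \<in> carrier_mat n n" for Z using H that by simp
        then show ?case using M M' by (simp add: zero)
      next
        case (Suc t)
        show ?case
          unfolding state_Suc state_Suc' push[OF M x] push[OF M' x'] Suc.IH markov[rule_format] ..
      qed
      from this[of 0] show ?thesis
        using H M M' by (simp add: network_output_def flip: H_def)
    qed
    then show "indistinguishable As Bs Cs R S Q Q'"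
      unfolding indistinguishable_def dims by (intro bexI[of _ "0\<^sub>v n"]) auto
  }
  assume "indistinguishable As Bs Cs R S Q Q'"
  then obtain x0 x0' where x0: "x0 \<in> carrier_vec n" "x0' \<in> carrier_vec n"
    and out: "\<And>u t. \<forall>t. u t \<in> carrier_vec m \<Longrightarrow>
      network_output As Bs Cs R S Q u x0 t = network_output As Bs Cs R S Q' u x0' t"
    unfolding indistinguishable_def dims by metis
  show "\<forall>k. H * M ^\<^sub>m k * G = H * M' ^\<^sub>m k * G"
  proof (intro allI, rule mat_col_eqI)
    fix k b assume "b < dim_col (H * M' ^\<^sub>m k * G)"
    then have b: "b < m" using G by simp
    let ?e = "unit_vec m b :: real vec"
    let ?impulse = "\<lambda>t :: nat. if t = 0 then ?e else 0\<^sub>v m"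
    \<comment> \<open>Subtracting the free response isolates one column of a Markov parameter and removes
      the initial state, which is different for the two networks.\<close>
    have response: "(H * Z ^\<^sub>m k * G) *\<^sub>v ?e = network_output As Bs Cs R S P ?impulse y (Suc k)
        - network_output As Bs Cs R S P (\<lambda>_. 0\<^sub>v m) y (Suc k)"
      if Z: "Z \<in> carrier_mat n n" and y: "y \<in> carrier_vec n"
        and Z_def: "Z = diag_block_mat As + diag_block_mat Bs * P * diag_block_mat Cs" for Z P y
    proof -
      note Z_Suc = network_state.simps(2)[of As Bs Cs R P, folded Z_def G_def]
      let ?free = "network_state As Bs Cs R P (\<lambda>_. 0\<^sub>v m) y"
        and ?forced = "network_state As Bs Cs R P ?impulse y"
      have G0: "G *\<^sub>v 0\<^sub>v m = 0\<^sub>v n" using G by (auto simp: vec_eq_iff)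
      have Ge: "G *\<^sub>v ?e \<in> carrier_vec n" using G by simp
      have free: "?free t \<in> carrier_vec n" for t
        by (induction t) (use y Z G in \<open>auto simp: Z_Suc simp del: network_state.simps(2)\<close>)
      have "?forced (Suc t) = ?free (Suc t) + Z ^\<^sub>m t *\<^sub>v (G *\<^sub>v ?e)" for t
      proof (induction t)
        case 0
        then show ?case using y Z Ge by (simp add: Z_Suc G0 del: network_state.simps(2))
      next
        case (Suc t)
        have Zt: "Z ^\<^sub>m t *\<^sub>v (G *\<^sub>v ?e) \<in> carrier_vec n"
          by (rule mult_mat_vec_carrier[OF pow_carrier_mat[OF Z] Ge])
        have "?forced (Suc (Suc t)) = Z *\<^sub>v ?forced (Suc t) + 0\<^sub>v n"
          by (subst Z_Suc) (simp add: G0 del: network_state.simps(2))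
        also have "\<dots> = Z *\<^sub>v ?free (Suc t) + Z *\<^sub>v (Z ^\<^sub>m t *\<^sub>v (G *\<^sub>v ?e))"
          unfolding Suc.IH mult_add_distrib_mat_vec[OF Z free Zt]
          by (rule right_zero_vec[OF add_carrier_vec[OF mult_mat_vec_carrier[OF Z free] mult_mat_vec_carrier[OF Z Zt]]])
        also have "Z *\<^sub>v (Z ^\<^sub>m t *\<^sub>v (G *\<^sub>v ?e)) = Z ^\<^sub>m Suc t *\<^sub>v (G *\<^sub>v ?e)"
          unfolding pow_mat_Suc_left[OF Z] by (rule assoc_mult_mat_vec[OF Z pow_carrier_mat[OF Z] Ge, symmetric])
        also have "Z *\<^sub>v ?free (Suc t) = ?free (Suc (Suc t))"
          using mult_mat_vec_carrier[OF Z free] by (subst (2) Z_Suc) (simp add: G0 del: network_state.simps(2))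
        finally show ?case .
      qed
      then have "H *\<^sub>v ?forced (Suc k) = H *\<^sub>v ?free (Suc k) + H *\<^sub>v (Z ^\<^sub>m k *\<^sub>v (G *\<^sub>v ?e))"
        by (simp only: mult_add_distrib_mat_vec[OF H free mult_mat_vec_carrier[OF pow_carrier_mat[OF Z] Ge]])
      also have "H *\<^sub>v (Z ^\<^sub>m k *\<^sub>v (G *\<^sub>v ?e)) = (H * Z ^\<^sub>m k * G) *\<^sub>v ?e"
        using assoc_mult_mat_vec[OF H pow_carrier_mat[OF Z] Ge]
          assoc_mult_mat_vec[OF mult_carrier_mat[OF H pow_carrier_mat[OF Z]] G, of ?e] by simp
      finally have "H *\<^sub>v ?forced (Suc k) = H *\<^sub>v ?free (Suc k) + (H * Z ^\<^sub>m k * G) *\<^sub>v ?e" .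
      then show ?thesis unfolding network_output_def H_def[symmetric] using H G Z
        by (auto simp: vec_eq_iff simp del: network_state.simps(2))
    qed
    have "(H * M ^\<^sub>m k * G) *\<^sub>v ?e = (H * M' ^\<^sub>m k * G) *\<^sub>v ?e"
      unfolding response[OF M x0(1) M_def] response[OF M' x0(2) M'_def]
      using out[of ?impulse] out[of "\<lambda>_. 0\<^sub>v m"] by simp
    moreover have "W *\<^sub>v ?e = col W b" if "W \<in> carrier_mat p m" for W :: "real mat"
      using that b by (auto simp: vec_eq_iff)
    ultimately show "col (H * M ^\<^sub>m k * G) b = col (H * M' ^\<^sub>m k * G) b"
      using mult_carrier_mat[OF mult_carrier_mat[OF H pow_carrier_mat[OF M]] G]
        mult_carrier_mat[OF mult_carrier_mat[OF H pow_carrier_mat[OF M']] G] by simp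
  qed (use H M M' G in auto)
qed

section \<open>Markov parameters of homogeneous networks\<close>

lemma diag_block_mat_replicate_carrier:
  "X \<in> carrier_mat a b \<Longrightarrow> diag_block_mat (replicate N X) \<in> carrier_mat (N * a) (N * b)"
  by (auto simp: dim_diag_block_mat sum_list_replicate map_replicate_const)

lemma diag_block_mat_replicate_mult:
  fixes X Y :: "'a :: semiring_0 mat"
  assumes X: "X \<in> carrier_mat a b" and Y: "Y \<in> carrier_mat b c"
  shows "diag_block_mat (replicate N X) * diag_block_mat (replicate N Y)
    = diag_block_mat (replicate N (X * Y))"
proof (induction N)
  case (Suc N)
  have XN: "diag_block_mat (replicate N X) \<in> carrier_mat (N * a) (N * b)"
    and YN: "diag_block_mat (replicate N Y) \<in> carrier_mat (N * b) (N * c)"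
    using X Y by (auto intro: diag_block_mat_replicate_carrier)
  have XYN: "diag_block_mat (replicate N (X * Y)) \<in> carrier_mat (N * a) (N * c)"
    using X Y by (intro diag_block_mat_replicate_carrier) simp
  show ?case
    using X Y XN YN Suc carrier_matD[OF XYN]
    by (simp add: Let_def left_add_zero_mat[OF XYN] mult_four_block_mat[OF X zero_carrier_mat zero_carrier_mat XN Y zero_carrier_mat
        zero_carrier_mat YN] del: assoc_mult_mat)
qed simp

lemma diag_block_mat_replicate_singleton:
  fixes X :: "'a :: semiring_1 mat"
  assumes X: "X \<in> carrier_mat 1 1"
  shows "diag_block_mat (replicate N X) = X $$ (0, 0) \<cdot>\<^sub>m 1\<^sub>m N"
proof (induction N)
  case (Suc N)
  then show ?case using X by (intro eq_matI) (auto simp: Let_def)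
qed (auto intro!: eq_matI)

text \<open>
  This is where homogeneity enters: a path that spends \<open>l + 1\<close> time steps in a node is weighted by
  the same scalar for each node, so the node dynamics commute with every interconnection matrix.
\<close>

lemma homogeneous_node_markov_parameters:
  fixes A0 B0 C0 :: "real mat"
  assumes A0: "A0 \<in> carrier_mat n0 n0" and B0: "B0 \<in> carrier_mat n0 1" and C0: "C0 \<in> carrier_mat 1 n0"
  shows "diag_block_mat (replicate N C0) * diag_block_mat (replicate N A0) ^\<^sub>m l * diag_block_mat (replicate N B0)
    = (C0 * A0 ^\<^sub>m l * B0) $$ (0, 0) \<cdot>\<^sub>m 1\<^sub>m N"
proof -
  have pow: "diag_block_mat (replicate N A0) ^\<^sub>m l = diag_block_mat (replicate N (A0 ^\<^sub>m l))"
    using A0 by (subst diag_block_pow_mat) (auto simp: map_replicate)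
  have "C0 * A0 ^\<^sub>m l * B0 \<in> carrier_mat 1 1"
    by (rule mult_carrier_mat[OF mult_carrier_mat[OF C0 pow_carrier_mat[OF A0]] B0])
  then show ?thesis
    unfolding pow diag_block_mat_replicate_mult[OF C0 pow_carrier_mat[OF A0]]
      diag_block_mat_replicate_mult[OF mult_carrier_mat[OF C0 pow_carrier_mat[OF A0]] B0]
    by (rule diag_block_mat_replicate_singleton)
qed

text \<open>
  Expanding one factor \<open>A + B Q C\<close> of the system matrix: a signal either stays inside its node for
  one more step, or leaves it through \<open>C A\<^sup>l B = g\<^sub>l I\<close> and passes \<open>Q\<close> once more. The indices count the
  transitions between nodes already made, the time spent in the present node, and the steps still
  to be expanded.
\<close>

lemma markov_parameter_recursion:
  fixes A B C Q R S :: "real mat"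
  assumes A: "A \<in> carrier_mat n n" and B: "B \<in> carrier_mat n N" and C: "C \<in> carrier_mat N n"
    and Q: "Q \<in> carrier_mat N N" and R: "R \<in> carrier_mat N m" and S: "S \<in> carrier_mat p N"
    and node: "\<And>l. C * A ^\<^sub>m l * B = g l \<cdot>\<^sub>m 1\<^sub>m N"
    and F: "\<And>j l k. F j l k = S * Q ^\<^sub>m j * C * A ^\<^sub>m l * ((A + B * Q * C) ^\<^sub>m k * (B * R))"
  shows "F j l 0 = g l \<cdot>\<^sub>m (S * Q ^\<^sub>m j * R)"
    and "F j l (Suc k) = F j (Suc l) k + g l \<cdot>\<^sub>m F (Suc j) 0 k"
    and "F j l k \<in> carrier_mat p m"
proof -
  let ?M = "A + B * Q * C"
  have BR: "B * R \<in> carrier_mat n m" using B R by simp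
  have BQC: "B * Q * C \<in> carrier_mat n n" using B Q C by simp
  have M: "?M \<in> carrier_mat n n" using A BQC by simp
  have SQ: "S * Q ^\<^sub>m j \<in> carrier_mat p N" for j using S Q by simp
  have CA: "C * A ^\<^sub>m l \<in> carrier_mat N n" for l using A C by simp
  have Al: "A ^\<^sub>m l \<in> carrier_mat n n" using A by simp
  have L: "S * Q ^\<^sub>m j * C * A ^\<^sub>m l \<in> carrier_mat p n"
    by (rule mult_carrier_mat[OF mult_carrier_mat[OF SQ C] Al])
  have K: "?M ^\<^sub>m k * (B * R) \<in> carrier_mat n m" for k
    by (rule mult_carrier_mat[OF pow_carrier_mat[OF M] BR])
  show "F j l k \<in> carrier_mat p m" unfolding F by (rule mult_carrier_mat[OF L K])
  have through_node: "S * Q ^\<^sub>m j * C * A ^\<^sub>m l * (B * Z) = g l \<cdot>\<^sub>m (S * Q ^\<^sub>m j * Z)"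
    if Z: "Z \<in> carrier_mat N c" for Z c
  proof -
    have "S * Q ^\<^sub>m j * C * A ^\<^sub>m l * (B * Z) = S * Q ^\<^sub>m j * (C * A ^\<^sub>m l) * B * Z"
      unfolding assoc_mult_mat[OF SQ C Al] assoc_mult_mat[OF mult_carrier_mat[OF SQ CA] B Z] ..
    also have "\<dots> = S * Q ^\<^sub>m j * (g l \<cdot>\<^sub>m 1\<^sub>m N) * Z"
      unfolding assoc_mult_mat[OF SQ CA B] node ..
    also have "\<dots> = g l \<cdot>\<^sub>m (S * Q ^\<^sub>m j * Z)"
      by (simp only: mult_smult_distrib[OF SQ one_carrier_mat] right_mult_one_mat[OF SQ]
        mult_smult_assoc_mat[OF SQ Z])
    finally show ?thesis .
  qed
  have "?M ^\<^sub>m 0 * (B * R) = B * R" using M BR by simp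
  then show "F j l 0 = g l \<cdot>\<^sub>m (S * Q ^\<^sub>m j * R)"
    unfolding F using through_node[OF R] by simp
  let ?K = "?M ^\<^sub>m k * (B * R)"
  have CK: "C * ?K \<in> carrier_mat N m" by (rule mult_carrier_mat[OF C K])
  have "?M ^\<^sub>m Suc k * (B * R) = ?M * ?K"
    unfolding pow_mat_Suc_left[OF M] by (rule assoc_mult_mat[OF M pow_carrier_mat[OF M] BR])
  also have "\<dots> = A * ?K + B * (Q * (C * ?K))"
    unfolding add_mult_distrib_mat[OF A BQC K] assoc_mult_mat[OF mult_carrier_mat[OF B Q] C K]
      assoc_mult_mat[OF B Q CK] ..
  finally have "F j l (Suc k) = S * Q ^\<^sub>m j * C * A ^\<^sub>m l * (A * ?K) + S * Q ^\<^sub>m j * C * A ^\<^sub>m l * (B * (Q * (C * ?K)))"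
    unfolding F
    using mult_add_distrib_mat[OF L mult_carrier_mat[OF A K] mult_carrier_mat[OF B mult_carrier_mat[OF Q CK]]]
    by simp
  also have "S * Q ^\<^sub>m j * C * A ^\<^sub>m l * (A * ?K) = F j (Suc l) k"
    unfolding F pow_mat.simps assoc_mult_mat[OF L A K, symmetric]
      assoc_mult_mat[OF mult_carrier_mat[OF SQ C] Al A] ..
  also have "S * Q ^\<^sub>m j * C * A ^\<^sub>m l * (B * (Q * (C * ?K))) = g l \<cdot>\<^sub>m (S * Q ^\<^sub>m j * (Q * (C * ?K)))"
    by (rule through_node[OF mult_carrier_mat[OF Q CK]])
  also have "S * Q ^\<^sub>m j * (Q * (C * ?K)) = F (Suc j) 0 k"
  proof -
    have "S * Q ^\<^sub>m j * (Q * (C * ?K)) = S * Q ^\<^sub>m Suc j * (C * ?K)"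
      unfolding assoc_mult_mat[OF SQ Q CK, symmetric] pow_mat.simps
        assoc_mult_mat[OF S pow_carrier_mat[OF Q] Q] ..
    also have "\<dots> = S * Q ^\<^sub>m Suc j * C * ?K" by (rule assoc_mult_mat[OF SQ C K, symmetric])
    also have "S * Q ^\<^sub>m Suc j * C = S * Q ^\<^sub>m Suc j * C * A ^\<^sub>m 0"
      using right_mult_one_mat[OF mult_carrier_mat[OF SQ C]] A by (simp del: pow_mat.simps(2))
    finally show ?thesis unfolding F .
  qed
  finally show "F j l (Suc k) = F j (Suc l) k + g l \<cdot>\<^sub>m F (Suc j) 0 k" .
qed

text \<open>
  The scalar form of the expansion of the Markov parameters, applied to each entry of the difference of
  two networks: \<open>F 0 0 k\<close> is the difference of the \<open>k\<close>-th Markov parameters, and \<open>e j\<close> that of the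
  products \<open>S Q\<^sup>j R\<close>. In the \<open>z\<close>-domain the recursion says that the generating function of \<open>F 0 0\<close>
  is \<open>\<Sum>j. e\<^sub>j G\<^bsup>j+1\<^esup>\<close>, where \<open>G\<close> is that of \<open>g\<close>.
\<close>

lemma coupled_recursion_all_zero:
  fixes F :: "nat \<Rightarrow> nat \<Rightarrow> nat \<Rightarrow> real"
  assumes start: "\<And>j l. F j l 0 = g l * e j"
    and step: "\<And>j l k. F j l (Suc k) = F j (Suc l) k + g l * F (Suc j) 0 k"
    and zero: "(\<forall>j. e j = 0) \<or> (\<forall>l. g l = 0)"
  shows "F j l k = 0"
  using zero by (induction k arbitrary: j l) (auto simp: start step)

text \<open>
  A nonzero series \<open>G\<close> in \<open>1/z\<close> without constant term has powers of distinct orders, which are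
  therefore linearly independent. Accordingly, the values \<open>e\<^sub>j\<close> are recovered one at a time from the
  index \<open>r\<close> of the leading coefficient of \<open>G\<close>.
\<close>

lemma coupled_recursion_determines:
  fixes F :: "nat \<Rightarrow> nat \<Rightarrow> nat \<Rightarrow> real"
  assumes start: "\<And>j l. F j l 0 = g l * e j"
    and step: "\<And>j l k. F j l (Suc k) = F j (Suc l) k + g l * F (Suc j) 0 k"
    and nonzero: "g k0 \<noteq> 0" and outer: "\<And>k. F 0 0 k = 0"
  shows "e j = 0"
proof -
  define r where "r = (LEAST l. g l \<noteq> 0)"
  have r: "g r \<noteq> 0" unfolding r_def using nonzero by (rule LeastI)
  have below: "g l = 0" if "l < r" for l
    using not_less_Least that unfolding r_def by blast
  \<comment> \<open>While the coefficients vanish, the recursion only moves a step from the third to the second index.\<close>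
  have shift: "F j 0 (l + k) = F j l k" if "l \<le> r" for j l k
    using that by (induction l arbitrary: k) (auto simp: step below simp flip: add_Suc_right)
  have next_level: "e j = 0 \<and> (\<forall>k. F (Suc j) 0 k = 0)" if outer_j: "\<And>k. F j 0 k = 0" for j
  proof -
    have at_r: "F j r k = 0" for k using shift[of r j k] outer_j by simp
    have e: "e j = 0" using at_r[of 0] start[of j r] r by simp
    have "F (Suc j) 0 k = 0" for k
    proof (induction k rule: less_induct)
      case (less k)
      have tail: "F j l k' = 0" if "k' \<le> k" for l k'
        using that by (induction k' arbitrary: l) (auto simp: start step e less.IH)
      from at_r[of "Suc k"] have "g r * F (Suc j) 0 k = 0" by (simp add: step tail)
      then show ?case using r by simp
    qed
    with e show ?thesis by blast
  qed
  have "\<forall>k. F j 0 k = 0" by (induction j) (use outer next_level in auto)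
  then show ?thesis using next_level by blast
qed

lemma network_markov_parameters_eq_iff:
  fixes A B C Q Q' R S :: "real mat"
  assumes A: "A \<in> carrier_mat n n" and B: "B \<in> carrier_mat n N" and C: "C \<in> carrier_mat N n"
    and Q: "Q \<in> carrier_mat N N" and Q': "Q' \<in> carrier_mat N N"
    and R: "R \<in> carrier_mat N m" and S: "S \<in> carrier_mat p N"
    and node: "\<And>l. C * A ^\<^sub>m l * B = g l \<cdot>\<^sub>m 1\<^sub>m N"
  shows "(\<forall>k. S * C * (A + B * Q * C) ^\<^sub>m k * (B * R) = S * C * (A + B * Q' * C) ^\<^sub>m k * (B * R))
    \<longleftrightarrow> (\<forall>l. g l = 0) \<or> (\<forall>j. S * Q ^\<^sub>m j * R = S * Q' ^\<^sub>m j * R)"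
    (is "?markov \<longleftrightarrow> _")
proof -
  define F where "F = (\<lambda>Z j l k. S * Z ^\<^sub>m j * C * A ^\<^sub>m l * ((A + B * Z * C) ^\<^sub>m k * (B * R)))"
  have F_eq: "F Z j l k = S * Z ^\<^sub>m j * C * A ^\<^sub>m l * ((A + B * Z * C) ^\<^sub>m k * (B * R))" for Z j l k
    by (simp add: F_def)
  note recQ = markov_parameter_recursion[where F = "F Q", OF A B C Q R S node F_eq]
    and recQ' = markov_parameter_recursion[where F = "F Q'", OF A B C Q' R S node F_eq]
  have F00: "F Z 0 0 k = S * C * (A + B * Z * C) ^\<^sub>m k * (B * R)" if Z: "Z \<in> carrier_mat N N" for Z k
  proof -
    have M: "A + B * Z * C \<in> carrier_mat n n" and BR: "B * R \<in> carrier_mat n m"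
      and SC: "S * C \<in> carrier_mat p n" using A B C R S Z by auto
    have "S * Z ^\<^sub>m 0 * C * A ^\<^sub>m 0 = S * C" using A C S Z SC by simp
    then show ?thesis
      unfolding F_def using assoc_mult_mat[OF SC pow_carrier_mat[OF M] BR] by simp
  qed
  define d where "d = (\<lambda>i b j l k. F Q j l k $$ (i, b) - F Q' j l k $$ (i, b))"
  define e where "e = (\<lambda>i b j. (S * Q ^\<^sub>m j * R) $$ (i, b) - (S * Q' ^\<^sub>m j * R) $$ (i, b))"
  have SQR: "S * Z ^\<^sub>m j * R \<in> carrier_mat p m" if "Z \<in> carrier_mat N N" for Z j
    by (rule mult_carrier_mat[OF mult_carrier_mat[OF S pow_carrier_mat[OF that]] R])
  have start: "d i b j l 0 = g l * e i b j" if "i < p" "b < m" for i b j l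
    using that carrier_matD[OF SQR[OF Q, of j]] carrier_matD[OF SQR[OF Q', of j]]
    unfolding d_def e_def recQ(1) recQ'(1) by (simp add: right_diff_distrib del: index_mult_mat(1))
  have step: "d i b j l (Suc k) = d i b j (Suc l) k + g l * d i b (Suc j) 0 k" if "i < p" "b < m" for i b j l k
    using that carrier_matD[OF recQ(3)] carrier_matD[OF recQ'(3)]
    unfolding d_def recQ(2) recQ'(2) by (simp add: right_diff_distrib)
  have markov: "?markov \<longleftrightarrow> (\<forall>i < p. \<forall>b < m. \<forall>k. d i b 0 0 k = 0)"
    unfolding F00[OF Q, symmetric] F00[OF Q', symmetric] d_def
    using carrier_matD[OF recQ(3)] carrier_matD[OF recQ'(3)] by (auto simp: mat_eq_iff)
  have outer: "(\<forall>j. S * Q ^\<^sub>m j * R = S * Q' ^\<^sub>m j * R) \<longleftrightarrow> (\<forall>i < p. \<forall>b < m. \<forall>j. e i b j = 0)"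
    unfolding e_def using carrier_matD[OF SQR[OF Q]] carrier_matD[OF SQR[OF Q']]
    by (auto simp: mat_eq_iff simp del: index_mult_mat(1))
  show ?thesis
  proof
    assume m: ?markov
    show "(\<forall>l. g l = 0) \<or> (\<forall>j. S * Q ^\<^sub>m j * R = S * Q' ^\<^sub>m j * R)"
    proof (rule disjCI)
      assume "\<not> (\<forall>j. S * Q ^\<^sub>m j * R = S * Q' ^\<^sub>m j * R)"
      then obtain i b j where ib: "i < p" "b < m" "e i b j \<noteq> 0" unfolding outer by blast
      show "\<forall>l. g l = 0"
        using coupled_recursion_determines[of "d i b" g "e i b", OF start[OF ib(1,2)] step[OF ib(1,2)]]
          m ib unfolding markov by blast
    qed
  next
    assume "(\<forall>l. g l = 0) \<or> (\<forall>j. S * Q ^\<^sub>m j * R = S * Q' ^\<^sub>m j * R)"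
    then have "(\<forall>j. e i b j = 0) \<or> (\<forall>l. g l = 0)" if "i < p" "b < m" for i b
      using that unfolding outer by blast
    then show ?markov unfolding markov
      using coupled_recursion_all_zero[of "d _ _" g "e _ _", OF start step] by blast
  qed
qed

section \<open>Interconnections with equal products\<close>

definition outer_prod :: "real vec \<Rightarrow> real vec \<Rightarrow> real mat" where
  "outer_prod v w = mat (dim_vec v) (dim_vec w) (\<lambda>(i, j). v $ i * w $ j)"

lemma outer_prod_carrier: "v \<in> carrier_vec a \<Longrightarrow> w \<in> carrier_vec b \<Longrightarrow> outer_prod v w \<in> carrier_mat a b"
  by (auto simp: outer_prod_def)

lemma mult_outer_prod:
  assumes M: "M \<in> carrier_mat a b" and v: "v \<in> carrier_vec b"
  shows "M * outer_prod v w = outer_prod (M *\<^sub>v v) w"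
  using assms by (intro eq_matI) (auto simp: outer_prod_def scalar_prod_def sum_distrib_left ac_simps)

lemma outer_prod_mult:
  assumes M: "M \<in> carrier_mat b c" and w: "w \<in> carrier_vec b"
  shows "outer_prod v w * M = outer_prod v (M\<^sup>T *\<^sub>v w)"
  using assms by (intro eq_matI) (auto simp: outer_prod_def scalar_prod_def sum_distrib_left ac_simps)

lemma outer_prod_zero:
  "outer_prod (0\<^sub>v a) w = 0\<^sub>m a (dim_vec w)" "outer_prod v (0\<^sub>v b) = 0\<^sub>m (dim_vec v) b"
  by (auto simp: outer_prod_def)

lemma outer_prod_eq_0_iff:
  assumes "v \<in> carrier_vec a" "w \<in> carrier_vec b"
  shows "outer_prod v w = 0\<^sub>m a b \<longleftrightarrow> v = 0\<^sub>v a \<or> w = 0\<^sub>v b"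
  using assms by (auto simp: outer_prod_def mat_eq_iff vec_eq_iff)

text \<open>
  A row vector that annihilates all \<open>Q\<^sup>j R\<close> gives a change of \<open>Q\<close> that no input can excite.
\<close>

lemma pow_add_outer_prod_mult:
  fixes Q R :: "real mat"
  assumes Q: "Q \<in> carrier_mat N N" and R: "R \<in> carrier_mat N m" and v: "v \<in> carrier_vec N"
    and w: "w \<in> carrier_vec N" and annihilates: "\<And>j. (Q ^\<^sub>m j * R)\<^sup>T *\<^sub>v w = 0\<^sub>v m"
  shows "(Q + outer_prod v w) ^\<^sub>m j * R = Q ^\<^sub>m j * R"
proof (induction j)
  case (Suc j)
  have E: "outer_prod v w \<in> carrier_mat N N" using v w by (rule outer_prod_carrier)
  have QE: "Q + outer_prod v w \<in> carrier_mat N N" using Q E by simp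
  have QR: "Q ^\<^sub>m j * R \<in> carrier_mat N m" by (rule mult_carrier_mat[OF pow_carrier_mat[OF Q] R])
  have "(Q + outer_prod v w) ^\<^sub>m Suc j * R = (Q + outer_prod v w) * (Q ^\<^sub>m j * R)"
    unfolding pow_mat_Suc_left[OF QE] assoc_mult_mat[OF QE pow_carrier_mat[OF QE] R] Suc.IH ..
  also have "\<dots> = Q * (Q ^\<^sub>m j * R) + outer_prod v w * (Q ^\<^sub>m j * R)"
    by (rule add_mult_distrib_mat[OF Q E QR])
  also have "outer_prod v w * (Q ^\<^sub>m j * R) = 0\<^sub>m N m"
    unfolding outer_prod_mult[OF QR w] annihilates outer_prod_zero using v by simp
  also have "Q * (Q ^\<^sub>m j * R) + 0\<^sub>m N m = Q ^\<^sub>m Suc j * R"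
    unfolding pow_mat_Suc_left[OF Q] assoc_mult_mat[OF Q pow_carrier_mat[OF Q] R]
    by (rule right_add_zero_mat[OF mult_carrier_mat[OF Q QR]])
  finally show ?case .
qed (use Q v w in \<open>auto simp: outer_prod_def\<close>)

text \<open>
  Dually, a change of \<open>Q\<close> whose range lies in the unobservable subspace never reaches the output.
\<close>

lemma mult_pow_add_outer_prod:
  fixes Q S :: "real mat"
  assumes Q: "Q \<in> carrier_mat N N" and S: "S \<in> carrier_mat p N" and v: "v \<in> carrier_vec N"
    and w: "w \<in> carrier_vec N" and annihilates: "\<And>j. (S * Q ^\<^sub>m j) *\<^sub>v v = 0\<^sub>v p"
  shows "S * (Q + outer_prod v w) ^\<^sub>m j = S * Q ^\<^sub>m j"
proof (induction j)
  case (Suc j)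
  have E: "outer_prod v w \<in> carrier_mat N N" using v w by (rule outer_prod_carrier)
  have QE: "Q + outer_prod v w \<in> carrier_mat N N" using Q E by simp
  have SQ: "S * Q ^\<^sub>m j \<in> carrier_mat p N" by (rule mult_carrier_mat[OF S pow_carrier_mat[OF Q]])
  have "S * (Q + outer_prod v w) ^\<^sub>m Suc j = S * Q ^\<^sub>m j * (Q + outer_prod v w)"
    unfolding pow_mat.simps assoc_mult_mat[OF S pow_carrier_mat[OF QE] QE, symmetric] Suc.IH ..
  also have "\<dots> = S * Q ^\<^sub>m j * Q + S * Q ^\<^sub>m j * outer_prod v w"
    by (rule mult_add_distrib_mat[OF SQ Q E])
  also have "S * Q ^\<^sub>m j * outer_prod v w = 0\<^sub>m p N"
    unfolding mult_outer_prod[OF SQ v] annihilates outer_prod_zero using w by simp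
  also have "S * Q ^\<^sub>m j * Q + 0\<^sub>m p N = S * Q ^\<^sub>m Suc j"
    unfolding pow_mat.simps assoc_mult_mat[OF S pow_carrier_mat[OF Q] Q, symmetric]
    by (rule right_add_zero_mat[OF mult_carrier_mat[OF SQ Q]])
  finally show ?case .
qed (use Q v w in \<open>auto simp: outer_prod_def\<close>)

lemma left_annihilator_of_all_powers:
  fixes Q R :: "real mat"
  assumes Q: "Q \<in> carrier_mat N N" and R: "R \<in> carrier_mat N m" and w: "w \<in> carrier_vec N"
    and small: "\<And>j. j < N \<Longrightarrow> (Q ^\<^sub>m j * R)\<^sup>T *\<^sub>v w = 0\<^sub>v m"
  shows "(Q ^\<^sub>m j * R)\<^sup>T *\<^sub>v w = 0\<^sub>v m"
proof (rule eq_vecI)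
  fix b assume "b < dim_vec (0\<^sub>v m :: real vec)"
  then have b: "b < m" by simp
  let ?w = "mat 1 N (\<lambda>(_, i). w $ i)" and ?r = "mat N 1 (\<lambda>(i, _). R $$ (i, b))"
  have entry: "(?w * Q ^\<^sub>m l * ?r) $$ (0, 0) = ((Q ^\<^sub>m l * R)\<^sup>T *\<^sub>v w) $ b" for l
  proof -
    have "?w * Q ^\<^sub>m l * ?r = ?w * (Q ^\<^sub>m l * ?r)" using Q by (intro assoc_mult_mat) auto
    then show ?thesis using Q R w b carrier_matD[OF pow_carrier_mat[OF Q, of l]]
      by (simp add: scalar_prod_def mult.commute del: assoc_mult_mat)
  qed
  have "(?w * Q ^\<^sub>m j * ?r) $$ (0, 0) = 0"
  proof (rule markov_parameters_vanish[OF Q])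
    show "(?w * Q ^\<^sub>m l * ?r) $$ (0, 0) = 0" if "l < N" for l
      unfolding entry small[OF that] using b by simp
  qed auto
  then show "((Q ^\<^sub>m j * R)\<^sup>T *\<^sub>v w) $ b = 0\<^sub>v m $ b" unfolding entry using b by simp
qed (use R in simp)

text \<open>
  If neither \<open>S\<close> nor \<open>R\<close> has rank \<open>N\<close>, a coordinate change of the form \<open>T = I + v w\<^sup>T\<close> with \<open>S v = 0\<close> and
  \<open>w\<^sup>T R = 0\<close> fixes both \<open>S\<close> and \<open>R\<close>, so \<open>Q\<close> and \<open>T\<^bsup>-1\<^esup> Q T\<close> give the same products. They are different:
  if \<open>T\<close> commuted with \<open>Q\<close>, then \<open>v\<close> would be an eigenvector of \<open>Q\<close> in the kernel of \<open>S\<close>, against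
  observability.
\<close>

lemma similar_interconnection_same_products:
  fixes Q R S :: "real mat"
  assumes Q: "Q \<in> carrier_mat N N" and R: "R \<in> carrier_mat N m" and S: "S \<in> carrier_mat p N"
    and v: "v \<in> carrier_vec N" "v \<noteq> 0\<^sub>v N" "S *\<^sub>v v = 0\<^sub>v p"
    and w: "w \<in> carrier_vec N" "w \<noteq> 0\<^sub>v N" "R\<^sup>T *\<^sub>v w = 0\<^sub>v m"
    and obs: "observable S Q"
  shows "\<exists>Q' \<in> carrier_mat N N. Q' \<noteq> Q \<and> (\<forall>j. S * Q' ^\<^sub>m j * R = S * Q ^\<^sub>m j * R)"
proof -
  \<comment> \<open>Changing the sign of the row vector if necessary makes the transvection below invertible.\<close>
  obtain w where w: "w \<in> carrier_vec N" "w \<noteq> 0\<^sub>v N" "R\<^sup>T *\<^sub>v w = 0\<^sub>v m" and wv: "w \<bullet> v \<noteq> - 1"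
  proof (cases "w \<bullet> v = - 1")
    case True
    have "- w \<in> carrier_vec N" "- w \<noteq> 0\<^sub>v N" "R\<^sup>T *\<^sub>v (- w) = 0\<^sub>v m" "(- w) \<bullet> v \<noteq> - 1"
      using w v R True by (auto simp: vec_eq_iff)
    then show ?thesis by (rule that)
  next
    case False
    with w show ?thesis by (intro that)
  qed
  define c where "c = 1 / (1 + w \<bullet> v)"
  have c: "c * (w \<bullet> v) = 1 - c" using wv by (simp add: c_def field_simps)
  define E where "E = outer_prod v w"
  define T where "T = 1\<^sub>m N + E"
  define T' where "T' = 1\<^sub>m N - c \<cdot>\<^sub>m E"
  have E: "E \<in> carrier_mat N N" using v w by (simp add: E_def outer_prod_carrier)
  have cE: "c \<cdot>\<^sub>m E \<in> carrier_mat N N" using E by simp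
  have one: "1\<^sub>m N \<in> carrier_mat N N" by simp
  have T: "T \<in> carrier_mat N N" and T': "T' \<in> carrier_mat N N" using E by (auto simp: T_def T'_def)
  have "outer_prod v w *\<^sub>v v = (w \<bullet> v) \<cdot>\<^sub>v v"
    using v w by (auto simp: vec_eq_iff outer_prod_def scalar_prod_def sum_distrib_left ac_simps)
  then have EE: "E * E = (w \<bullet> v) \<cdot>\<^sub>m E"
    using mult_outer_prod[OF E v(1), of w] v w unfolding E_def
    by (auto simp: outer_prod_def mat_eq_iff)
  have TT': "T * T' = 1\<^sub>m N"
  proof -
    have "T * T' = T' + E * T'"
      unfolding T_def using add_mult_distrib_mat[OF one E T'] T' by simp
    also have "E * T' = E - c \<cdot>\<^sub>m ((w \<bullet> v) \<cdot>\<^sub>m E)"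
      unfolding T'_def using mult_minus_distrib_mat[OF E one cE] mult_smult_distrib[OF E E, of c] E EE by simp
    also have "c \<cdot>\<^sub>m ((w \<bullet> v) \<cdot>\<^sub>m E) = (1 - c) \<cdot>\<^sub>m E"
      using c by (auto simp: mat_eq_iff simp flip: mult.assoc)
    finally show ?thesis
      using E by (auto simp: mat_eq_iff T'_def algebra_simps)
  qed
  have T'T: "T' * T = 1\<^sub>m N" by (rule mat_mult_left_right_inverse[OF T T' TT'])
  have SE: "S * E = 0\<^sub>m p N"
    unfolding E_def mult_outer_prod[OF S v(1)] v(3) outer_prod_zero using w by simp
  have ER: "E * R = 0\<^sub>m N m"
    unfolding E_def outer_prod_mult[OF R w(1)] w(3) outer_prod_zero using v by simp
  have ST': "S * T' = S"
    unfolding T'_def mult_minus_distrib_mat[OF S one cE] mult_smult_distrib[OF S E] SE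
    using S by (auto simp: mat_eq_iff)
  have TR: "T * R = R"
    unfolding T_def add_mult_distrib_mat[OF one E R] ER using R by simp
  define Q' where "Q' = T' * Q * T"
  have Q': "Q' \<in> carrier_mat N N" using T Q T' by (simp add: Q'_def)
  have sim: "similar_mat_wit Q' Q T' T"
    by (rule similar_mat_witI[OF T'T TT' Q'_def Q' Q T' T])
  have same: "S * Q' ^\<^sub>m j * R = S * Q ^\<^sub>m j * R" for j
  proof -
    have P: "Q ^\<^sub>m j \<in> carrier_mat N N" using Q by simp
    have "S * Q' ^\<^sub>m j * R = S * (T' * Q ^\<^sub>m j * T) * R"
      using similar_mat_wit_pow_id[OF sim] by simp
    also have "\<dots> = S * T' * Q ^\<^sub>m j * (T * R)"
      using assoc_mult_mat[OF S T' P] assoc_mult_mat[OF S mult_carrier_mat[OF T' P] T]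
        assoc_mult_mat[OF mult_carrier_mat[OF S mult_carrier_mat[OF T' P]] T R] by simp
    finally show ?thesis unfolding ST' TR .
  qed
  have "Q' \<noteq> Q"
  proof
    assume eq: "Q' = Q"
    have "T * Q = T * T' * Q * T"
      using eq assoc_mult_mat[OF T mult_carrier_mat[OF T' Q] T] assoc_mult_mat[OF T T' Q]
      by (simp add: Q'_def)
    then have "T * Q = Q * T" using TT' Q by simp
    moreover have "T * Q = Q + E * Q" "Q * T = Q + Q * E"
      unfolding T_def using add_mult_distrib_mat[OF one E Q] mult_add_distrib_mat[OF Q one E] Q by auto
    ultimately have sum_eq: "Q + E * Q = Q + Q * E" by simp
    have commute: "outer_prod (Q *\<^sub>v v) w = outer_prod v (Q\<^sup>T *\<^sub>v w)"
    proof -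
      have "E * Q \<in> carrier_mat N N" "Q * E \<in> carrier_mat N N" using E Q by auto
      with sum_eq Q have "E * Q = Q * E"
        by (auto simp: mat_eq_iff simp del: index_mult_mat(1))
      then show ?thesis unfolding E_def mult_outer_prod[OF Q v(1)] outer_prod_mult[OF Q w(1)] ..
    qed
    obtain i where i: "i < N" "w $ i \<noteq> 0" using w by (auto simp: vec_eq_iff)
    define \<mu> where "\<mu> = (Q\<^sup>T *\<^sub>v w) $ i / w $ i"
    \<comment> \<open>Comparing one column of the two rank one matrices makes the kernel vector of
      \<^term>\<open>S\<close> an eigenvector of \<^term>\<open>Q\<close>.\<close>
    have eigen: "Q *\<^sub>v v = \<mu> \<cdot>\<^sub>v v"
    proof (rule eq_vecI)
      fix k assume "k < dim_vec (\<mu> \<cdot>\<^sub>v v)"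
      then have k: "k < N" using v by simp
      have "outer_prod (Q *\<^sub>v v) w $$ (k, i) = outer_prod v (Q\<^sup>T *\<^sub>v w) $$ (k, i)"
        using commute by simp
      then have "(Q *\<^sub>v v) $ k * w $ i = v $ k * (Q\<^sup>T *\<^sub>v w) $ i"
        using i k v(1) w(1) Q by (simp add: outer_prod_def del: index_mult_mat_vec)
      then show "(Q *\<^sub>v v) $ k = (\<mu> \<cdot>\<^sub>v v) $ k"
        using i k v(1) by (simp add: \<mu>_def field_simps del: index_mult_mat_vec)
    qed (use Q v in simp)
    have "(S * Q ^\<^sub>m k) *\<^sub>v v = 0\<^sub>v p" for k
    proof -
      have "Q ^\<^sub>m k *\<^sub>v v = \<mu> ^ k \<cdot>\<^sub>v v"
      proof (induction k)
        case (Suc k)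
        have "Q ^\<^sub>m Suc k *\<^sub>v v = Q ^\<^sub>m k *\<^sub>v (\<mu> \<cdot>\<^sub>v v)"
          using assoc_mult_mat_vec[OF pow_carrier_mat[OF Q] Q v(1)] by (simp add: eigen)
        also have "\<dots> = \<mu> \<cdot>\<^sub>v (\<mu> ^ k \<cdot>\<^sub>v v)"
          unfolding mult_mat_vec[OF pow_carrier_mat[OF Q] v(1)] Suc.IH ..
        finally show ?case by (simp add: smult_smult_assoc)
      qed (use Q v in simp)
      then have "(S * Q ^\<^sub>m k) *\<^sub>v v = \<mu> ^ k \<cdot>\<^sub>v (S *\<^sub>v v)"
        using assoc_mult_mat_vec[OF S pow_carrier_mat[OF Q] v(1)] mult_mat_vec[OF S v(1)] by simp
      also have "\<dots> = 0\<^sub>v p" unfolding v(3) by auto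
      finally show ?thesis .
    qed
    then have "v = 0\<^sub>v N" using obs Q S v(1) by (auto simp: observable_def)
    with v(2) show False by simp
  qed
  with Q' same show ?thesis by blast
qed

text \<open>
  Cancelling \<open>S\<close> gives \<open>Q' Q\<^sup>j R = Q'\<^bsup>j+1\<^esup> R = Q\<^bsup>j+1\<^esup> R\<close>, so every row of \<open>Q' - Q\<close> annihilates all blocks
  of the controllability matrix.
\<close>

lemma interconnection_determined_if_controllable:
  fixes Q Q' R S :: "real mat"
  assumes Q: "Q \<in> carrier_mat N N" and Q': "Q' \<in> carrier_mat N N"
    and R: "R \<in> carrier_mat N m" and S: "S \<in> carrier_mat p N"
    and rank: "mat_rank S = N" and ctrl: "controllable Q R"
    and same: "\<And>j. S * Q' ^\<^sub>m j * R = S * Q ^\<^sub>m j * R"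
  shows "Q' = Q"
proof -
  define D where "D = Q' - Q"
  have D: "D \<in> carrier_mat N N" unfolding D_def by (rule minus_carrier_mat[OF Q])
  have cancel: "X = Y" if X: "X \<in> carrier_mat N m" and Y: "Y \<in> carrier_mat N m" and eq: "S * X = S * Y" for X Y
  proof (rule mat_col_eqI)
    fix b assume "b < dim_col Y"
    then have b: "b < m" using Y by simp
    have cols: "col X b \<in> carrier_vec N" "col Y b \<in> carrier_vec N" using X Y b by auto
    have "S *\<^sub>v col X b = S *\<^sub>v col Y b"
      using col_mult2[OF S X b] col_mult2[OF S Y b] eq by simp
    then have "S *\<^sub>v (col X b - col Y b) = 0\<^sub>v p"
      using mult_minus_distrib_mat_vec[OF S cols] mult_mat_vec_carrier[OF S cols(2)] by simp
    then have "col X b - col Y b = 0\<^sub>v N"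
      using rank cols unfolding mat_rank_eq_dim_col_iff[OF S] by simp
    with cols show "col X b = col Y b" by (rule eq_vec_if_minus_0)
  qed (use X Y in auto)
  have powers: "Q' ^\<^sub>m j * R = Q ^\<^sub>m j * R" for j
  proof (rule cancel)
    show "S * (Q' ^\<^sub>m j * R) = S * (Q ^\<^sub>m j * R)"
      using same assoc_mult_mat[OF S pow_carrier_mat[OF Q'] R] assoc_mult_mat[OF S pow_carrier_mat[OF Q] R]
      by metis
  qed (use mult_carrier_mat[OF pow_carrier_mat[OF Q'] R] mult_carrier_mat[OF pow_carrier_mat[OF Q] R] in auto)
  have D_powers: "D * (Q ^\<^sub>m j * R) = 0\<^sub>m N m" for j
  proof -
    have QR: "Q ^\<^sub>m j * R \<in> carrier_mat N m" by (rule mult_carrier_mat[OF pow_carrier_mat[OF Q] R])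
    have "Q' * (Q ^\<^sub>m j * R) = Q' ^\<^sub>m Suc j * R"
      unfolding powers[symmetric] pow_mat_Suc_left[OF Q']
      by (rule assoc_mult_mat[OF Q' pow_carrier_mat[OF Q'] R, symmetric])
    also have "\<dots> = Q * (Q ^\<^sub>m j * R)"
      unfolding powers pow_mat_Suc_left[OF Q] by (rule assoc_mult_mat[OF Q pow_carrier_mat[OF Q] R])
    finally show ?thesis
      unfolding D_def minus_mult_distrib_mat[OF Q' Q QR] using mult_carrier_mat[OF Q QR] by simp
  qed
  have "row D i = 0\<^sub>v N" if i: "i < N" for i
  proof -
    have "(Q ^\<^sub>m j * R)\<^sup>T *\<^sub>v row D i = 0\<^sub>v m" for j
    proof (rule eq_vecI)
      have QR: "Q ^\<^sub>m j * R \<in> carrier_mat N m" by (rule mult_carrier_mat[OF pow_carrier_mat[OF Q] R])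
      fix b assume "b < dim_vec (0\<^sub>v m :: real vec)"
      then have b: "b < m" by simp
      have "((Q ^\<^sub>m j * R)\<^sup>T *\<^sub>v row D i) $ b = (D * (Q ^\<^sub>m j * R)) $$ (i, b)"
        using i b D QR carrier_matD[OF QR]
        by (simp add: comm_scalar_prod[of _ N] row_carrier_vec[OF i] del: assoc_mult_mat)
      also have "\<dots> = 0" unfolding D_powers using i b by simp
      finally show "((Q ^\<^sub>m j * R)\<^sup>T *\<^sub>v row D i) $ b = 0\<^sub>v m $ b" using b by simp
    qed (use R in simp)
    then show ?thesis using ctrl i D unfolding controllable_iff[OF Q R] by auto
  qed
  then have "D = 0\<^sub>m N N" using D by (intro eq_rowI) auto
  then show ?thesis using Q Q' by (auto simp: D_def mat_eq_iff)
qed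

text \<open>
  The dual argument: cancelling \<open>R\<close> puts every column of \<open>Q' - Q\<close> into the unobservable subspace.
\<close>

lemma interconnection_determined_if_observable:
  fixes Q Q' R S :: "real mat"
  assumes Q: "Q \<in> carrier_mat N N" and Q': "Q' \<in> carrier_mat N N"
    and R: "R \<in> carrier_mat N m" and S: "S \<in> carrier_mat p N"
    and rank: "mat_rank R = N" and obs: "observable S Q"
    and same: "\<And>j. S * Q' ^\<^sub>m j * R = S * Q ^\<^sub>m j * R"
  shows "Q' = Q"
proof -
  define D where "D = Q' - Q"
  have D: "D \<in> carrier_mat N N" unfolding D_def by (rule minus_carrier_mat[OF Q])
  have cancel: "X = Y" if X: "X \<in> carrier_mat p N" and Y: "Y \<in> carrier_mat p N" and eq: "X * R = Y * R" for X Y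
  proof (rule eq_rowI)
    fix i assume "i < dim_row Y"
    then have i: "i < p" using Y by simp
    have rows: "row X i \<in> carrier_vec N" "row Y i \<in> carrier_vec N" using X Y i by auto
    have "R\<^sup>T *\<^sub>v row Z i = row (Z * R) i" if "Z \<in> carrier_mat p N" for Z
      using that R i by (auto simp: vec_eq_iff comm_scalar_prod[of _ N])
    then have "R\<^sup>T *\<^sub>v row X i = R\<^sup>T *\<^sub>v row Y i" using X Y eq by simp
    then have "R\<^sup>T *\<^sub>v (row X i - row Y i) = 0\<^sub>v m"
      using mult_minus_distrib_mat_vec[OF _ rows, of "R\<^sup>T" m]
        mult_mat_vec_carrier[OF _ rows(2), of "R\<^sup>T" m] R by simp
    then have "row X i - row Y i = 0\<^sub>v N"
      using rank rows unfolding mat_rank_eq_dim_row_iff[OF R] by simp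
    with rows show "row X i = row Y i" by (rule eq_vec_if_minus_0)
  qed (use X Y in auto)
  have powers: "S * Q' ^\<^sub>m j = S * Q ^\<^sub>m j" for j
    by (rule cancel)
      (use same mult_carrier_mat[OF S pow_carrier_mat[OF Q']] mult_carrier_mat[OF S pow_carrier_mat[OF Q]] in auto)
  have D_powers: "S * Q ^\<^sub>m j * D = 0\<^sub>m p N" for j
  proof -
    have SQ: "S * Q ^\<^sub>m j \<in> carrier_mat p N" by (rule mult_carrier_mat[OF S pow_carrier_mat[OF Q]])
    have "S * Q ^\<^sub>m j * Q' = S * Q' ^\<^sub>m Suc j"
      unfolding powers[symmetric] pow_mat.simps by (rule assoc_mult_mat[OF S pow_carrier_mat[OF Q'] Q'])
    also have "\<dots> = S * Q ^\<^sub>m j * Q"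
      unfolding powers unfolding pow_mat.simps by (rule assoc_mult_mat[OF S pow_carrier_mat[OF Q] Q, symmetric])
    finally show ?thesis
      unfolding D_def mult_minus_distrib_mat[OF SQ Q' Q] using mult_carrier_mat[OF SQ Q] by simp
  qed
  have "col D i = 0\<^sub>v N" if i: "i < N" for i
  proof -
    have SQ: "S * Q ^\<^sub>m j \<in> carrier_mat p N" for j by (rule mult_carrier_mat[OF S pow_carrier_mat[OF Q]])
    have "(S * Q ^\<^sub>m j) *\<^sub>v col D i = 0\<^sub>v p" for j
      using col_mult2[OF SQ D i] i unfolding D_powers by simp
    then show ?thesis using obs i D Q S unfolding observable_def by auto
  qed
  then have "D = 0\<^sub>m N N" using D by (intro mat_col_eqI) auto
  then show ?thesis using Q Q' by (auto simp: D_def mat_eq_iff)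
qed

lemma interconnection_determined_iff:
  fixes Q R S :: "real mat"
  assumes N: "N \<ge> 1" and Q: "Q \<in> carrier_mat N N" and R: "R \<in> carrier_mat N m" and S: "S \<in> carrier_mat p N"
  shows "(\<forall>Q' \<in> carrier_mat N N. (\<forall>j. S * Q' ^\<^sub>m j * R = S * Q ^\<^sub>m j * R) \<longrightarrow> Q' = Q) \<longleftrightarrow>
    (mat_rank S = N \<and> controllable Q R) \<or> (mat_rank R = N \<and> observable S Q)"
    (is "?determined \<longleftrightarrow> _")
proof
  assume det: ?determined
  \<comment> \<open>An arbitrary nonzero vector, which completes an uncontrollable or unobservable direction to a
    rank one matrix.\<close>
  define e where "e = (unit_vec N 0 :: real vec)"
  have e: "e \<in> carrier_vec N" "e \<noteq> 0\<^sub>v N" using N by (auto simp: e_def)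
  have not_perturbed: "v = 0\<^sub>v N \<or> w = 0\<^sub>v N"
    if vw: "v \<in> carrier_vec N" "w \<in> carrier_vec N"
      and same: "\<forall>j. S * (Q + outer_prod v w) ^\<^sub>m j * R = S * Q ^\<^sub>m j * R" for v w
  proof -
    have E: "outer_prod v w \<in> carrier_mat N N" using vw by (rule outer_prod_carrier)
    with det same Q have "Q + outer_prod v w = Q" by simp
    then have "outer_prod v w = 0\<^sub>m N N" using E Q by (auto simp: mat_eq_iff)
    then show ?thesis using outer_prod_eq_0_iff[OF vw] by simp
  qed
  have ctrl: "controllable Q R"
    unfolding controllable_iff[OF Q R]
  proof (intro ballI impI)
    fix w assume w: "w \<in> carrier_vec N" and "\<forall>j < N. (Q ^\<^sub>m j * R)\<^sup>T *\<^sub>v w = 0\<^sub>v m"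
    then have "(Q ^\<^sub>m j * R)\<^sup>T *\<^sub>v w = 0\<^sub>v m" for j using left_annihilator_of_all_powers[OF Q R] by blast
    then have pw: "(Q + outer_prod e w) ^\<^sub>m j * R = Q ^\<^sub>m j * R" for j
      by (rule pow_add_outer_prod_mult[OF Q R e(1) w])
    have "Q + outer_prod e w \<in> carrier_mat N N" using Q outer_prod_carrier[OF e(1) w] by simp
    then have "S * (Q + outer_prod e w) ^\<^sub>m j * R = S * Q ^\<^sub>m j * R" for j
      using assoc_mult_mat[OF S pow_carrier_mat R] Q pw by metis
    then show "w = 0\<^sub>v N" using not_perturbed[OF e(1) w] e(2) by blast
  qed
  have obs: "observable S Q"
    unfolding observable_def
  proof (intro ballI impI)
    fix v assume "v \<in> carrier_vec (dim_row Q)" and "\<forall>k. (S * Q ^\<^sub>m k) *\<^sub>v v = 0\<^sub>v (dim_row S)"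
    then have v: "v \<in> carrier_vec N" and ann: "(S * Q ^\<^sub>m k) *\<^sub>v v = 0\<^sub>v p" for k using Q S by auto
    have "S * (Q + outer_prod v e) ^\<^sub>m j * R = S * Q ^\<^sub>m j * R" for j
      using mult_pow_add_outer_prod[OF Q S v e(1) ann] by simp
    then show "v = 0\<^sub>v (dim_row Q)" using not_perturbed[OF v e(1)] e(2) Q by simp
  qed
  show "(mat_rank S = N \<and> controllable Q R) \<or> (mat_rank R = N \<and> observable S Q)"
  proof (rule ccontr)
    assume "\<not> ?thesis"
    then have "mat_rank S \<noteq> N" "mat_rank R \<noteq> N" using ctrl obs by auto
    then obtain v w where
      "v \<in> carrier_vec N" "v \<noteq> 0\<^sub>v N" "S *\<^sub>v v = 0\<^sub>v p"
      "w \<in> carrier_vec N" "w \<noteq> 0\<^sub>v N" "R\<^sup>T *\<^sub>v w = 0\<^sub>v m"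
      unfolding mat_rank_eq_dim_col_iff[OF S] mat_rank_eq_dim_row_iff[OF R] by blast
    from similar_interconnection_same_products[OF Q R S this obs] det show False by blast
  qed
next
  assume "(mat_rank S = N \<and> controllable Q R) \<or> (mat_rank R = N \<and> observable S Q)"
  then show ?determined
    using interconnection_determined_if_controllable[OF Q _ R S]
      interconnection_determined_if_observable[OF Q _ R S] by blast
qed

section \<open>Identifiability of homogeneous networks\<close>

theorem theorem7:
  fixes N n0 m p :: nat
    and A0 B0 C0 Q R S :: "real mat"
  assumes "N \<ge> 1"
    and "A0 \<in> carrier_mat n0 n0" and "B0 \<in> carrier_mat n0 1" and "C0 \<in> carrier_mat 1 n0"
    and "Q \<in> carrier_mat N N" and "R \<in> carrier_mat N m" and "S \<in> carrier_mat p N"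
  shows "topology_identifiable (replicate N A0) (replicate N B0) (replicate N C0) R S Q \<longleftrightarrow>
    transfer_mat A0 B0 C0 \<noteq> 0\<^sub>m 1 1 \<and>
    ((mat_rank S = N \<and> controllable Q R) \<or> (mat_rank R = N \<and> observable S Q))"
proof -
  note N = assms(1) and A0 = assms(2) and B0 = assms(3) and C0 = assms(4)
    and Q = assms(5) and R = assms(6) and S = assms(7)
  let ?g = "\<lambda>l. (C0 * A0 ^\<^sub>m l * B0) $$ (0, 0)"
  have A: "diag_block_mat (replicate N A0) \<in> carrier_mat (N * n0) (N * n0)"
    and B: "diag_block_mat (replicate N B0) \<in> carrier_mat (N * n0) N"
    and C: "diag_block_mat (replicate N C0) \<in> carrier_mat N (N * n0)"
    using diag_block_mat_replicate_carrier[OF A0, of N] diag_block_mat_replicate_carrier[OF B0, of N]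
      diag_block_mat_replicate_carrier[OF C0, of N] by auto
  have indist: "indistinguishable (replicate N A0) (replicate N B0) (replicate N C0) R S Q Q' \<longleftrightarrow>
      (\<forall>l. ?g l = 0) \<or> (\<forall>j. S * Q ^\<^sub>m j * R = S * Q' ^\<^sub>m j * R)" if Q': "Q' \<in> carrier_mat N N" for Q'
    using indistinguishable_iff_markov_parameters[OF A B C Q Q' R S refl refl refl refl]
      network_markov_parameters_eq_iff[OF A B C Q Q' R S homogeneous_node_markov_parameters[OF A0 B0 C0]]
    by blast
  have other: "\<exists>Q' \<in> carrier_mat N N. Q' \<noteq> Q"
  proof
    have "Q $$ (0, 0) + 1 \<noteq> Q $$ (0, 0)" by simp
    moreover have "(Q + 1\<^sub>m N) $$ (0, 0) = Q $$ (0, 0) + 1" using Q N by simp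
    ultimately show "Q + 1\<^sub>m N \<noteq> Q" by metis
    show "Q + 1\<^sub>m N \<in> carrier_mat N N" using Q by simp
  qed
  have "topology_identifiable (replicate N A0) (replicate N B0) (replicate N C0) R S Q \<longleftrightarrow>
      \<not> (\<forall>l. ?g l = 0) \<and>
      (\<forall>Q' \<in> carrier_mat N N. (\<forall>j. S * Q' ^\<^sub>m j * R = S * Q ^\<^sub>m j * R) \<longrightarrow> Q' = Q)"
    using other Q unfolding topology_identifiable_def by (auto simp: indist)
  then show ?thesis
    unfolding transfer_mat_eq_0_iff[OF A0 B0 C0] interconnection_determined_iff[OF N Q R S] .
qed

end
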